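(* Let $p$ be an odd prime and $\alpha,\beta\in\mathbb Z_p$. Suppose that $\langle-\beta\rangle_p<p/2$ and $(2\beta)_{p-1}\not\equiv0\pmod{p^2}$. If $\langle-\alpha\rangle_p$ is even, then $$ {}_3F_2\bigg[\begin{matrix}\alpha&1-\alpha&\beta\\&1&2\beta\end{matrix}\bigg|\,1\bigg]_{p-1}\equiv-\frac{\Gamma_p(\frac12)\Gamma_p(\frac12+\beta)\Gamma_p(\beta)}{\Gamma_p(\frac12+\frac12\alpha)\Gamma_p(1-\frac12\alpha)\Gamma_p(\frac12+\beta-\frac12\alpha)\Gamma_p(\beta+\frac12\alpha)}\pmod{p^2}. $$ If $\langle-\alpha\rangle_p$ is odd, then $$ {}_3F_2\bigg[\begin{matrix}\alpha&1-\alpha&\beta\\&1&2\beta\end{matrix}\bigg|\,1\bigg]_{p-1}\equiv0\pmod{p^2}. $$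
   Context: $\mathbb Z_p$ denotes the $p$-adic integers. For $\alpha\in\mathbb Z_p$, $\langle\alpha\rangle_p$ is the unique integer in $\{0,1,\ldots,p-1\}$ congruent to $\alpha$ modulo $p$. Pochhammer symbol: $(x)_0=1$, $(x)_k=x(x+1)\cdots(x+k-1)$. For $n\ge 0$ the truncated hypergeometric series is ${}_{m+1}F_m\Big[\begin{matrix}\alpha_0&\alpha_1&\ldots&\alpha_m\\&\beta_1&\ldots&\beta_m\end{matrix}\Big|\,z\Big]_n=\sum_{k=0}^{n}\frac{(\alpha_0)_k\cdots(\alpha_m)_k}{(\beta_1)_k\cdots(\beta_m)_k}\cdot\frac{z^k}{k!}$. $\Gamma_p$ is Morita's $p$-adic gamma function: $\Gamma_p(n)=(-1)^n\prod_{1\le j<n,\ p\nmid j}j$ for integers $n\ge1$, $\Gamma_p(0)=1$, extended to $\mathbb Z_p$ by continuity. For $x,y\in\mathbb Q_p$, $x\equiv y\pmod{p^2}$ means $x-y\in p^2\mathbb Z_p$. *)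

theory Defs
  imports
    Complex_Main
    "HOL-Computational_Algebra.Polynomial_Factorial"
    "Berlekamp_Zassenhaus.Finite_Field"
begin

section \<open>The ring of p-adic integers\<close>

text \<open>
  The prime is the cardinality of a type of class \<^class>\<open>prime_card\<close>. The p-adic integers are the
  inverse limit of the rings of integers modulo \<open>p ^ n\<close>; the coherence condition below also forces
  the \<open>n\<close>-th entry into \<open>{0..<p ^ n}\<close>.
\<close>

typedef (overloaded) 'p padic_int =
  "{f :: nat \<Rightarrow> int. \<forall>n. f (Suc n) mod int CARD('p::prime_card) ^ n = f n}"
  by (rule exI[of _ "\<lambda>_. 0"]) simp

setup_lifting type_definition_padic_int

lemma padic_coherent_modE:
  fixes m :: int
  assumes "\<forall>n. f (Suc n) mod m ^ n = f n"
  shows "f n mod m ^ n = f n"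
  by (metis assms mod_mod_trivial)

lemma padic_coherent_op:
  fixes m :: int
  assumes "a' mod m ^ n = a" "b' mod m ^ n = b"
  shows "((a' + b') mod m ^ Suc n) mod m ^ n = (a + b) mod m ^ n"
    and "((a' * b') mod m ^ Suc n) mod m ^ n = (a * b) mod m ^ n"
    and "((- a') mod m ^ Suc n) mod m ^ n = (- a) mod m ^ n"
  using assms by (auto simp: mod_mod_cancel mod_add_eq mod_mult_eq mod_minus_eq)

instantiation padic_int :: (prime_card) comm_ring
begin

lift_definition zero_padic_int :: "'a padic_int" is "\<lambda>_. 0" by simp

lift_definition plus_padic_int :: "'a padic_int \<Rightarrow> 'a padic_int \<Rightarrow> 'a padic_int"
  is "\<lambda>f g n. (f n + g n) mod int CARD('a) ^ n"
  by (blast intro: padic_coherent_op)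

lift_definition times_padic_int :: "'a padic_int \<Rightarrow> 'a padic_int \<Rightarrow> 'a padic_int"
  is "\<lambda>f g n. (f n * g n) mod int CARD('a) ^ n"
  by (blast intro: padic_coherent_op)

lift_definition uminus_padic_int :: "'a padic_int \<Rightarrow> 'a padic_int"
  is "\<lambda>f n. (- f n) mod int CARD('a) ^ n"
  by (blast intro: padic_coherent_op)

definition minus_padic_int :: "'a padic_int \<Rightarrow> 'a padic_int \<Rightarrow> 'a padic_int"
  where "minus_padic_int x y = x + - y"

instance
proof
  fix a b c :: "'a padic_int"
  show "a * b * c = a * (b * c)"
    by transfer (simp add: fun_eq_iff mod_mult_left_eq mod_mult_right_eq mult.assoc)
  show "a * b = b * a"
    by transfer (simp add: mult.commute)
  show "a + b + c = a + (b + c)"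
    by transfer (simp add: fun_eq_iff mod_add_left_eq mod_add_right_eq add.assoc)
  show "a + b = b + a"
    by transfer (simp add: add.commute)
  show "0 + a = a"
    by transfer (simp add: fun_eq_iff padic_coherent_modE)
  show "- a + a = 0"
    by transfer (simp add: fun_eq_iff mod_add_left_eq)
  show "a - b = a + - b"
    by (rule minus_padic_int_def)
  show "(a + b) * c = a * c + b * c"
    by transfer (simp add: fun_eq_iff mod_add_eq mod_mult_left_eq distrib_right)
qed

end

lemma CARD_prime_card_gt_1: "1 < CARD('p::prime_card)"
  using prime_card[where 'a = 'p] prime_gt_1_nat by blast

instantiation padic_int :: (prime_card) comm_ring_1
begin

lift_definition one_padic_int :: "'a padic_int" is "\<lambda>n. 1 mod int CARD('a) ^ n"
  by (simp add: mod_mod_cancel)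

instance
proof
  fix a :: "'a padic_int"
  show "1 * a = a"
    by transfer (simp add: fun_eq_iff mod_mult_left_eq padic_coherent_modE)
  show "(0 :: 'a padic_int) \<noteq> 1"
    using CARD_prime_card_gt_1[where 'p = 'a]
    by transfer (auto simp: fun_eq_iff intro!: exI[of _ 1])
qed

end

lemma Rep_padic_int_0: "Rep_padic_int 0 n = 0"
  by transfer simp

lemma Rep_padic_int_1: "Rep_padic_int (1 :: 'p::prime_card padic_int) n = 1 mod int CARD('p) ^ n"
  by transfer simp

lemma Rep_padic_int_add:
  "Rep_padic_int (x + y) n =
     (Rep_padic_int x n + Rep_padic_int y n) mod int CARD('p) ^ n"
  for x y :: "'p::prime_card padic_int"
  by transfer simp

lemma Rep_padic_int_mult:
  "Rep_padic_int (x * y) n =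
     (Rep_padic_int x n * Rep_padic_int y n) mod int CARD('p) ^ n"
  for x y :: "'p::prime_card padic_int"
  by transfer simp

lemma Rep_padic_int_of_nat:
  "Rep_padic_int (of_nat k :: 'p::prime_card padic_int) n = int k mod int CARD('p) ^ n"
  by (induction k)
     (simp_all add: Rep_padic_int_0 Rep_padic_int_1 Rep_padic_int_add mod_add_eq add.commute)

lemma Rep_padic_int_mod:
  "Rep_padic_int x (n + k) mod int CARD('p) ^ n = Rep_padic_int x n"
  for x :: "'p::prime_card padic_int"
proof (induction k)
  case 0
  show ?case
    using padic_coherent_modE[of "Rep_padic_int x"] Rep_padic_int[of x] by simp
next
  case (Suc k)
  have "Rep_padic_int x (Suc (n + k)) mod int CARD('p) ^ (n + k) = Rep_padic_int x (n + k)"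
    using Rep_padic_int[of x] by simp
  then have "Rep_padic_int x (Suc (n + k)) mod int CARD('p) ^ n
      = Rep_padic_int x (n + k) mod int CARD('p) ^ n"
    by (metis mod_mod_cancel le_imp_power_dvd le_add1)
  with Suc show ?case by simp
qed

lemma padic_int_eqI: "(\<And>n. Rep_padic_int x n = Rep_padic_int y n) \<Longrightarrow> x = y"
  by (metis Rep_padic_int_inject ext)

instance padic_int :: (prime_card) ring_char_0
proof
  show "inj (of_nat :: nat \<Rightarrow> 'a padic_int)"
  proof (rule injI)
    fix a b :: nat
    assume eq: "(of_nat a :: 'a padic_int) = of_nat b"
    define n where "n = a + b"
    have lt: "n < CARD('a) ^ n"
      using CARD_prime_card_gt_1[where 'p = 'a] by (intro power_gt_expt) simp
    have "int a mod int CARD('a) ^ n = int b mod int CARD('a) ^ n"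
      using eq by (metis Rep_padic_int_of_nat)
    then have "a mod CARD('a) ^ n = b mod CARD('a) ^ n"
      by (metis of_nat_eq_iff of_nat_mod of_nat_power)
    with lt show "a = b" by (simp add: n_def)
  qed
qed

lemma padic_int_power_dvd_iff:
  "of_nat CARD('p) ^ k dvd x \<longleftrightarrow> Rep_padic_int x k = 0" for x :: "'p::prime_card padic_int"
proof
  assume "of_nat CARD('p) ^ k dvd x"
  then obtain y where "x = of_nat (CARD('p) ^ k) * y" by (auto simp: dvd_def)
  then show "Rep_padic_int x k = 0"
    by (simp only: Rep_padic_int_mult Rep_padic_int_of_nat) simp
next
  assume 0: "Rep_padic_int x k = 0"
  let ?p = "int CARD('p)"
  let ?f = "Rep_padic_int x"
  define g where "g n = ?f (n + k) div ?p ^ k" for n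
  have "g (Suc n) mod ?p ^ n = g n" for n
  proof -
    have "?f (n + k) = ?f (n + k + 1) mod (?p ^ k * ?p ^ n)"
      using Rep_padic_int_mod[of x "n + k" 1] by (simp add: power_add mult.commute)
    also have "\<dots> = ?p ^ k * (?f (n + k + 1) div ?p ^ k mod ?p ^ n) + ?f (n + k + 1) mod ?p ^ k"
      by (rule zmod_zmult2_eq) simp
    also have "?f (n + k + 1) mod ?p ^ k = 0"
      using Rep_padic_int_mod[of x k "n + 1"] 0 by (simp add: add_ac)
    finally show ?thesis
      by (simp add: g_def)
  qed
  then have g: "Rep_padic_int (Abs_padic_int g :: 'p padic_int) = g"
    by (intro Abs_padic_int_inverse) simp
  have "x = of_nat (CARD('p) ^ k) * Abs_padic_int g"
  proof (rule padic_int_eqI)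
    fix n
    have "?f (n + k) mod ?p ^ k = 0"
      using Rep_padic_int_mod[of x k n] 0 by (simp add: add_ac)
    then have "?p ^ k * g n = ?f (n + k)"
      by (auto simp: g_def)
    then have "?p ^ k * g n mod ?p ^ n = ?f n"
      by (simp add: Rep_padic_int_mod)
    then show "?f n = Rep_padic_int (of_nat (CARD('p) ^ k) * Abs_padic_int g :: 'p padic_int) n"
      by (simp only: Rep_padic_int_mult Rep_padic_int_of_nat g) (simp add: mod_mult_left_eq)
  qed
  then show "of_nat CARD('p) ^ k dvd x" by simp
qed

lemma padic_int_unit:
  fixes x :: "'p::prime_card padic_int"
  assumes "Rep_padic_int x 1 \<noteq> 0"
  shows "x dvd 1"
proof -
  let ?p = "int CARD('p)"
  let ?f = "Rep_padic_int x"
  have p: "prime ?p" using prime_card[where 'a = 'p] by simp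
  have cop: "coprime (?f n) (?p ^ n)" for n
  proof (cases n)
    case (Suc m)
    have "?f n mod ?p = ?f 1" using Rep_padic_int_mod[of x 1 m] Suc by simp
    with assms have "\<not> ?p dvd ?f n" by auto
    with p show ?thesis
      by (metis coprime_commute coprime_power_left_iff prime_imp_coprime)
  qed simp
  have "\<exists>y. y mod ?p ^ n = y \<and> [?f n * y = 1] (mod ?p ^ n)" for n
  proof -
    obtain y where "[?f n * y = 1] (mod ?p ^ n)"
      using cong_solve_coprime_int[OF cop] by blast
    then have "[?f n * (y mod ?p ^ n) = 1] (mod ?p ^ n)"
      by (simp add: cong_def mod_mult_right_eq)
    then show ?thesis by (intro exI[of _ "y mod ?p ^ n"]) simp
  qed
  then obtain g where g: "\<And>n. g n mod ?p ^ n = g n" "\<And>n. [?f n * g n = 1] (mod ?p ^ n)"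
    by metis
  have "g (Suc n) mod ?p ^ n = g n" for n
  proof -
    have "[?f (Suc n) * g (Suc n) = 1] (mod ?p ^ n)"
      by (rule cong_dvd_modulus[OF g(2)]) (simp add: le_imp_power_dvd)
    moreover have "[?f (Suc n) = ?f n] (mod ?p ^ n)"
      using Rep_padic_int_mod[of x n 1] Rep_padic_int_mod[of x n 0] by (simp add: cong_def)
    ultimately have "[?f n * g (Suc n) = ?f n * g n] (mod ?p ^ n)"
      using g(2)[of n] by (meson cong_scalar_right cong_sym cong_trans)
    then have "[g (Suc n) = g n] (mod ?p ^ n)"
      using cong_mult_lcancel[OF cop] by blast
    with g(1)[of n] show ?thesis by (simp add: cong_def)
  qed
  then have rep: "Rep_padic_int (Abs_padic_int g :: 'p padic_int) = g"
    by (intro Abs_padic_int_inverse) simp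
  have "x * Abs_padic_int g = 1"
    using g(2) by (intro padic_int_eqI)
      (simp add: Rep_padic_int_mult Rep_padic_int_1 rep cong_def)
  then show ?thesis by (metis dvd_triv_left)
qed

lemma padic_int_decompose:
  fixes x :: "'p::prime_card padic_int"
  assumes "x \<noteq> 0"
  obtains k u where "x = of_nat CARD('p) ^ k * u" "u dvd 1"
proof -
  let ?p = "of_nat CARD('p) :: 'p padic_int"
  have "\<exists>n. Rep_padic_int x n \<noteq> 0"
    using assms padic_int_eqI[of x 0] by (auto simp: Rep_padic_int_0)
  then have "\<exists>n. Rep_padic_int x n \<noteq> 0 \<and> (\<forall>m<n. \<not> Rep_padic_int x m \<noteq> 0)"
    by (rule exists_least_iff[THEN iffD1])
  then obtain n where n: "Rep_padic_int x n \<noteq> 0" "\<And>m. m < n \<Longrightarrow> Rep_padic_int x m = 0"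
    by auto
  have "n \<noteq> 0"
    using n(1) Rep_padic_int_mod[of x 0 0] by (intro notI) simp
  then obtain k where k: "n = Suc k" by (cases n) auto
  with n(2) have "?p ^ k dvd x" by (simp add: padic_int_power_dvd_iff)
  then obtain u where u: "x = ?p ^ k * u" by (elim dvdE)
  have "Rep_padic_int u 1 \<noteq> 0"
  proof
    assume "Rep_padic_int u 1 = 0"
    then have "?p ^ 1 dvd u" by (simp only: padic_int_power_dvd_iff)
    then have "?p ^ n dvd x" by (simp add: u k mult.commute[of ?p] mult_dvd_mono)
    with n(1) show False by (simp add: padic_int_power_dvd_iff)
  qed
  with u show ?thesis by (intro that padic_int_unit)
qed

lemma padic_int_p_not_unit: "\<not> of_nat CARD('p::prime_card) dvd (1 :: 'p padic_int)"
  using padic_int_power_dvd_iff[of 1 "1 :: 'p padic_int"] CARD_prime_card_gt_1[where 'p = 'p]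
  by (simp add: Rep_padic_int_1)

instance padic_int :: (prime_card) idom
proof
  fix x y :: "'a padic_int"
  assume "x \<noteq> 0" "y \<noteq> 0"
  then obtain k u l v where x: "x = of_nat CARD('a) ^ k * u" "u dvd 1"
    and y: "y = of_nat CARD('a) ^ l * v" "v dvd 1"
    by (metis padic_int_decompose)
  then obtain u' v' where "1 = u * u'" "1 = v * v'" by (auto simp: dvd_def)
  then have "x * y * (u' * v') = of_nat (CARD('a) ^ (k + l))"
  proof -
    have "x * y * (u' * v') = of_nat CARD('a) ^ k * of_nat CARD('a) ^ l * ((u * u') * (v * v'))"
      unfolding x(1) y(1) by (simp only: mult_ac)
    also have "\<dots> = of_nat (CARD('a) ^ (k + l))"
      by (simp add: power_add flip: \<open>1 = u * u'\<close> \<open>1 = v * v'\<close>)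
    finally show ?thesis .
  qed
  moreover have "of_nat (CARD('a) ^ (k + l)) \<noteq> (0 :: 'a padic_int)"
    using CARD_prime_card_gt_1[where 'p = 'a] by (simp only: of_nat_eq_0_iff) simp
  ultimately show "x * y \<noteq> 0" by auto
qed


section \<open>The field of p-adic numbers\<close>

text \<open>A copy of the fraction field, so that it can carry a metric.\<close>

typedef (overloaded) 'p padic = "UNIV :: 'p::prime_card padic_int fract set" ..

lifting_forget padic_int.lifting

setup_lifting type_definition_padic

instantiation padic :: (prime_card) field
begin

lift_definition zero_padic :: "'a padic" is 0 .
lift_definition one_padic :: "'a padic" is 1 .
lift_definition plus_padic :: "'a padic \<Rightarrow> 'a padic \<Rightarrow> 'a padic" is "(+)" .
lift_definition minus_padic :: "'a padic \<Rightarrow> 'a padic \<Rightarrow> 'a padic" is "(-)" .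
lift_definition uminus_padic :: "'a padic \<Rightarrow> 'a padic" is uminus .
lift_definition times_padic :: "'a padic \<Rightarrow> 'a padic \<Rightarrow> 'a padic" is "(*)" .
lift_definition inverse_padic :: "'a padic \<Rightarrow> 'a padic" is inverse .
lift_definition divide_padic :: "'a padic \<Rightarrow> 'a padic \<Rightarrow> 'a padic" is "(/)" .

instance
proof
  fix a b c :: "'a padic"
  show "a * b * c = a * (b * c)" by transfer (rule mult.assoc)
  show "a * b = b * a" by transfer (rule mult.commute)
  show "1 * a = a" by transfer (rule mult_1_left)
  show "a + b + c = a + (b + c)" by transfer (rule add.assoc)
  show "a + b = b + a" by transfer (rule add.commute)
  show "0 + a = a" by transfer (rule add_0_left)
  show "- a + a = 0" by transfer (rule left_minus)
  show "a - b = a + - b" by transfer (rule diff_conv_add_uminus)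
  show "(a + b) * c = a * c + b * c" by transfer (rule distrib_right)
  show "(0 :: 'a padic) \<noteq> 1" by transfer (rule zero_neq_one)
  show "a \<noteq> 0 \<Longrightarrow> inverse a * a = 1" by transfer (rule left_inverse)
  show "a div b = a * inverse b" by transfer (rule divide_inverse)
  show "inverse (0 :: 'a padic) = 0" by transfer (rule inverse_zero)
qed

end

lift_definition of_padic_int :: "'p::prime_card padic_int \<Rightarrow> 'p padic" is to_fract .

lemma of_padic_int_hom [simp]:
  "of_padic_int 0 = 0" "of_padic_int 1 = 1"
  "of_padic_int (x + y) = of_padic_int x + of_padic_int y"
  "of_padic_int (x - y) = of_padic_int x - of_padic_int y"
  "of_padic_int (- x) = - of_padic_int x"
  "of_padic_int (x * y) = of_padic_int x * of_padic_int y"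
  by (transfer; simp)+

lemma of_padic_int_eq_iff [simp]: "of_padic_int x = of_padic_int y \<longleftrightarrow> x = y"
  by transfer simp

lemma of_padic_int_eq_0_iff [simp]: "of_padic_int x = 0 \<longleftrightarrow> x = 0"
  by (metis of_padic_int_eq_iff of_padic_int_hom(1))

lemma of_padic_int_of_nat [simp]: "of_padic_int (of_nat n) = of_nat n"
  by (induction n) simp_all

lemma of_padic_int_power [simp]: "of_padic_int (x ^ n) = of_padic_int x ^ n"
  by (induction n) simp_all

instance padic :: (prime_card) field_char_0
proof
  show "inj (of_nat :: nat \<Rightarrow> 'a padic)"
    by (rule injI) (metis of_padic_int_eq_iff of_padic_int_of_nat of_nat_eq_iff)
qed

definition padic_ints :: "'p::prime_card padic set"
  where "padic_ints = range of_padic_int"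

definition padic_cong :: "nat \<Rightarrow> 'p::prime_card padic \<Rightarrow> 'p padic \<Rightarrow> bool"
  where "padic_cong k x y \<longleftrightarrow> x - y \<in> (*) (of_nat CARD('p) ^ k) ` padic_ints"

definition padic_residue :: "'p::prime_card padic \<Rightarrow> nat"
  where "padic_residue x = (THE r. r < CARD('p) \<and> padic_cong 1 x (of_nat r))"

text \<open>The valuation of a nonzero \<open>x\<close>: the largest integer \<open>n\<close> with \<open>x \<in> p ^ n \<int>\<^sub>p\<close>.\<close>

definition padic_val :: "'p::prime_card padic \<Rightarrow> int"
  where "padic_val x = (GREATEST n. x / of_nat CARD('p) powi n \<in> padic_ints)"

definition padic_abs :: "'p::prime_card padic \<Rightarrow> real"
  where "padic_abs x = (if x = 0 then 0 else real CARD('p) powi (- padic_val x))"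

lemma padic_ints_closed [simp, intro]:
  fixes x y :: "'p::prime_card padic" and a :: "'p padic_int"
  shows "(0 :: 'p padic) \<in> padic_ints" "(1 :: 'p padic) \<in> padic_ints"
    "(of_nat n :: 'p padic) \<in> padic_ints" "of_padic_int a \<in> padic_ints"
    "x \<in> padic_ints \<Longrightarrow> y \<in> padic_ints \<Longrightarrow> x + y \<in> padic_ints"
    "x \<in> padic_ints \<Longrightarrow> y \<in> padic_ints \<Longrightarrow> x * y \<in> padic_ints"
    "x \<in> padic_ints \<Longrightarrow> - x \<in> padic_ints"
proof -
  have *: "of_padic_int b \<in> padic_ints" for b :: "'p padic_int"
    by (simp add: padic_ints_def)
  then show "of_padic_int a \<in> padic_ints" .
  show "(0 :: 'p padic) \<in> padic_ints" "(1 :: 'p padic) \<in> padic_ints"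
    "(of_nat n :: 'p padic) \<in> padic_ints"
    using *[of 0] *[of 1] *[of "of_nat n"] by simp_all
  show "x + y \<in> padic_ints" "x * y \<in> padic_ints"
    if xy: "x \<in> padic_ints" "y \<in> padic_ints"
  proof -
    obtain a b where "x = of_padic_int a" "y = of_padic_int b"
      using xy by (auto simp: padic_ints_def)
    then show "x + y \<in> padic_ints" "x * y \<in> padic_ints"
      using *[of "a + b"] *[of "a * b"] by simp_all
  qed
  show "- x \<in> padic_ints" if x: "x \<in> padic_ints"
  proof -
    obtain a where "x = of_padic_int a"
      using x by (auto simp: padic_ints_def)
    then show ?thesis
      using *[of "- a"] by simp
  qed
qed

lemma of_nat_CARD_padic_neq_0 [simp]: "of_nat CARD('p::prime_card) \<noteq> (0 :: 'p padic)"
  using CARD_prime_card_gt_1[where 'p = 'p] by (simp only: of_nat_eq_0_iff)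

lemma padic_decompose:
  fixes x :: "'p::prime_card padic"
  assumes "x \<noteq> 0"
  obtains k u where "x = of_nat CARD('p) powi k * of_padic_int u" "u dvd 1"
proof -
  let ?p = "of_nat CARD('p) :: 'p padic"
  obtain a b where ab: "x = of_padic_int a / of_padic_int b" "b \<noteq> 0"
  proof -
    have "\<exists>a b. x = of_padic_int a / of_padic_int b \<and> b \<noteq> 0"
    proof transfer
      fix x :: "'p padic_int fract"
      show "\<exists>a b. x = to_fract a / to_fract b \<and> b \<noteq> 0"
      proof (cases x)
        case (Fract a b)
        then have "x = to_fract a / to_fract b" by (simp add: to_fract_def)
        with Fract show ?thesis by blast
      qed
    qed
    with that show ?thesis by blast
  qed
  with assms have "a \<noteq> 0" by auto
  then obtain k u where a: "a = of_nat CARD('p) ^ k * u" "u dvd 1"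
    by (rule padic_int_decompose)
  from ab(2) obtain l v where b: "b = of_nat CARD('p) ^ l * v" "v dvd 1"
    by (rule padic_int_decompose)
  from b(2) obtain w where w: "1 = v * w" by (elim dvdE)
  then have vw: "of_padic_int v * of_padic_int w = (1 :: 'p padic)"
    by (metis of_padic_int_hom(2,6))
  then have "inverse (of_padic_int v) = (of_padic_int w :: 'p padic)"
    by (rule inverse_unique)
  then have "x = ?p powi (int k - int l) * of_padic_int (u * w)"
    by (simp add: ab(1) a(1) b(1) power_int_diff divide_inverse)
  moreover have "u * w dvd 1"
    using a(2) w by (metis dvd_triv_right is_unit_mult_iff)
  ultimately show ?thesis by (rule that)
qed

lemma padic_in_power_mono:
  fixes x :: "'p::prime_card padic"
  assumes "x / of_nat CARD('p) powi n \<in> padic_ints" "m \<le> n"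
  shows "x / of_nat CARD('p) powi m \<in> padic_ints"
proof -
  let ?p = "of_nat CARD('p) :: 'p padic"
  have "x / ?p powi m = x / ?p powi n * ?p powi (n - m)"
    by (simp add: power_int_diff)
  also have "?p powi (n - m) = of_nat (CARD('p) ^ nat (n - m))"
    using assms(2) by (simp add: power_int_def)
  finally show ?thesis using assms(1) by (simp only: padic_ints_closed)
qed

lemma padic_in_power_iff:
  fixes x :: "'p::prime_card padic"
  assumes "x \<noteq> 0"
  shows "x / of_nat CARD('p) powi n \<in> padic_ints \<longleftrightarrow> n \<le> padic_val x"
proof -
  let ?p = "of_nat CARD('p) :: 'p padic"
  obtain k u where x: "x = ?p powi k * of_padic_int u" "u dvd 1"
    using assms by (rule padic_decompose)
  obtain w where w: "1 = u * w" using x(2) by (elim dvdE)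
  then have uw: "of_padic_int u * of_padic_int w = (1 :: 'p padic)"
    by (metis of_padic_int_hom(2,6))
  have k: "x / ?p powi k \<in> padic_ints" by (simp add: x(1))
  have le: "n \<le> k" if "x / ?p powi n \<in> padic_ints" for n
  proof (rule ccontr)
    assume "\<not> n \<le> k"
    with that have "x / ?p powi (k + 1) \<in> padic_ints"
      by (intro padic_in_power_mono[OF that]) simp
    then have "x / ?p powi (k + 1) * of_padic_int w \<in> padic_ints" by blast
    also have "x / ?p powi (k + 1) * of_padic_int w = inverse ?p"
      using uw by (simp add: x(1) power_int_add field_simps)
    finally obtain c where "inverse ?p = of_padic_int c" by (auto simp: padic_ints_def)
    then have "of_padic_int (of_nat CARD('p) * c) = (of_padic_int 1 :: 'p padic)"
      by (metis of_padic_int_hom(2,6) of_padic_int_of_nat right_inverse of_nat_CARD_padic_neq_0)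
    then show False
      using padic_int_p_not_unit[where 'p = 'p] by (metis dvd_triv_left of_padic_int_eq_iff)
  qed
  have "padic_val x = k"
    unfolding padic_val_def using k le by (rule Greatest_equality)
  with k le padic_in_power_mono[of x k] show ?thesis by blast
qed

lemma padic_abs_nonneg [simp]: "0 \<le> padic_abs x"
  by (simp add: padic_abs_def)

lemma padic_abs_eq_0_iff: "padic_abs x = 0 \<longleftrightarrow> x = 0"
  by (simp add: padic_abs_def)

lemma padic_abs_minus: "padic_abs (- x) = padic_abs x"
proof -
  have "- y / c \<in> padic_ints \<longleftrightarrow> y / c \<in> padic_ints" for y c :: "'a padic"
    using padic_ints_closed(7)[of "y / c"] padic_ints_closed(7)[of "- y / c"] by auto
  then show ?thesis by (simp add: padic_abs_def padic_val_def)
qed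

lemma padic_abs_ultrametric: "padic_abs (x + y) \<le> max (padic_abs x) (padic_abs y)"
  for x y :: "'p::prime_card padic"
proof (cases "x = 0 \<or> y = 0 \<or> x + y = 0")
  case True
  then show ?thesis by (auto simp: padic_abs_eq_0_iff[THEN iffD2] le_max_iff_disj)
next
  case False
  define n where "n = min (padic_val x) (padic_val y)"
  have "(x + y) / of_nat CARD('p) powi n \<in> padic_ints"
    unfolding add_divide_distrib using False
    by (intro padic_ints_closed) (simp_all add: padic_in_power_iff n_def)
  with False have "n \<le> padic_val (x + y)" by (simp add: padic_in_power_iff)
  then have "real CARD('p) powi (- padic_val (x + y)) \<le> real CARD('p) powi (- n)"
    using CARD_prime_card_gt_1[where 'p = 'p] by (intro power_int_increasing) simp_all
  with False show ?thesis
    by (auto simp: padic_abs_def n_def min_def max_def split: if_splits)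
qed

instantiation padic :: (prime_card) metric_space
begin

definition dist_padic :: "'a padic \<Rightarrow> 'a padic \<Rightarrow> real"
  where "dist_padic x y = padic_abs (x - y)"

definition uniformity_padic :: "('a padic \<times> 'a padic) filter"
  where "uniformity_padic = (INF e\<in>{0<..}. principal {(x, y). dist x y < e})"

definition open_padic :: "'a padic set \<Rightarrow> bool"
  where "open_padic U \<longleftrightarrow> (\<forall>x\<in>U. eventually (\<lambda>(x', y). x' = x \<longrightarrow> y \<in> U) uniformity)"

instance
proof
  fix x y z :: "'a padic"
  show "dist x y = 0 \<longleftrightarrow> x = y"
    by (simp add: dist_padic_def padic_abs_eq_0_iff)
  have "padic_abs (x - y) \<le> max (padic_abs (x - z)) (padic_abs (- (y - z)))"
    using padic_abs_ultrametric[of "x - z" "- (y - z)"] by simp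
  also have "\<dots> \<le> padic_abs (x - z) + padic_abs (y - z)"
    unfolding padic_abs_minus by (simp add: max_def)
  finally show "dist x y \<le> dist x z + dist y z"
    by (simp add: dist_padic_def)
qed (simp_all add: uniformity_padic_def open_padic_def)

end


section \<open>Morita's gamma function and truncated hypergeometric series\<close>

text \<open>
  For odd \<open>p\<close> exactly one function satisfies the description: the natural numbers are dense in
  \<open>\<int>\<^sub>p\<close>, and the last conjunct fixes the (irrelevant) value \<open>0\<close> outside \<open>\<int>\<^sub>p\<close>.
\<close>

definition padic_Gamma :: "'p::prime_card padic \<Rightarrow> 'p padic"
  where "padic_Gamma = (THE f.
    continuous_on padic_ints f \<and>
    f 0 = 1 \<and>
    (\<forall>n\<ge>1. f (of_nat n) = (- 1) ^ n * (\<Prod>j\<in>{j. 1 \<le> j \<and> j < n \<and> \<not> CARD('p) dvd j}. of_nat j)) \<and>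
    (\<forall>x. x \<notin> padic_ints \<longrightarrow> f x = 0))"

definition trunc_hypergeo :: "'a::field_char_0 list \<Rightarrow> 'a list \<Rightarrow> 'a \<Rightarrow> nat \<Rightarrow> 'a"
  where "trunc_hypergeo as bs z n =
    (\<Sum>k\<le>n. (\<Prod>a\<leftarrow>as. pochhammer a k) / (\<Prod>b\<leftarrow>bs. pochhammer b k) * (z ^ k / fact k))"

end

theory Submission
  imports Defs "HOL-Number_Theory.Residues"
begin

text \<open>
  Write \<open>\<alpha> = - a + p * s\<close> with \<open>a = \<langle>- \<alpha>\<rangle>\<^sub>p\<close>. Modulo \<open>p\<^sup>2\<close> both sides of the congruence are affine
  functions of \<open>s\<close>: the sum because it is a polynomial in \<open>\<alpha>\<close> with p-integral coefficients, the
  gamma quotient because \<open>\<Gamma>\<^sub>p (r + p * y)\<close> is an explicit product modulo \<open>p\<^sup>2\<close> for \<open>0 \<le> r < p\<close>. So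
  it suffices to treat \<open>s = 0\<close> and \<open>s = 1\<close>. As both sides are invariant under \<open>\<alpha> \<mapsto> 1 - \<alpha>\<close>, these
  are the cases \<open>\<alpha> = - n\<close> with \<open>n = a\<close> and \<open>n = p - 1 - a\<close>, which have the same parity. There the
  sum terminates and a case of Whipple's theorem evaluates it; the functional equation of \<open>\<Gamma>\<^sub>p\<close>
  gives the same value on the other side.
\<close>

section \<open>Products of units modulo prime powers\<close>

text \<open>Two obstacles shape the argument. The first is the denominator
  \<open>pochhammer (2 * \<beta>) k\<close>: with \<open>b\<close> the residue of
  \<open>- \<beta>\<close>, it contains the factor \<open>2 * \<beta> + 2 * b\<close>, divisible by
  \<open>p\<close>, as soon as \<open>k > 2 * b\<close>. Because \<open>b < p / 2\<close>, the
  numerator has met its own multiple of \<open>p\<close> by then, so the coefficients of the sum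
  stay integral. The same bound keeps the relevant gamma arguments from crossing a multiple of
  \<open>p\<close>, so that the functional equation never switches to its exceptional factor
  \<open>- 1\<close>. The second is that \<open>padic_Gamma\<close> is only given by continuity. The
  extension from the natural numbers needs periodicity of the products modulo \<open>p ^ k\<close>,
  which amounts to Wilson's theorem for prime powers. Affine behaviour modulo \<open>p ^ 2\<close>
  needs more: a block of \<open>p\<close> consecutive factors has to be known modulo
  \<open>p ^ 2\<close>, one power beyond its length. A reflection of the block supplies this extra
  power, and the same gain drives the induction for Wilson's theorem.\<close>

definition unit_part :: "nat \<Rightarrow> int \<Rightarrow> int"
  where "unit_part p x = (if int p dvd x then 1 else x)"

lemma unit_part_cong:
  assumes "[x = y] (mod int p ^ k)"
  shows "[unit_part p x = unit_part p y] (mod int p ^ k)"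
proof (cases k)
  case (Suc l)
  then have "[x = y] (mod int p)"
    using assms by (metis cong_dvd_modulus dvd_triv_left power_Suc)
  with assms show ?thesis
    by (simp add: unit_part_def cong_dvd_iff)
qed auto

text \<open>In the expanded product every term of degree at least two in \<open>t\<close> carries
  \<open>q\<^sup>2\<close>. What matters later is that one slope \<open>c\<close> serves all
  \<open>t\<close>.\<close>

lemma prod_add_cong_linear:
  fixes q :: int
  assumes "finite U"
  shows "\<exists>c. \<forall>t. [(\<Prod>j\<in>U. f j + q * t) = (\<Prod>j\<in>U. f j) + q * t * c] (mod q\<^sup>2)"
  using assms
proof (induction U rule: finite_induct)
  case empty
  show ?case by (rule exI[of _ 0]) simp
next
  case (insert x U)
  then obtain c where c: "[(\<Prod>j\<in>U. f j + q * t) = (\<Prod>j\<in>U. f j) + q * t * c] (mod q\<^sup>2)" for t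
    by blast
  have "[(f x + q * t) * (\<Prod>j\<in>U. f j + q * t) = f x * (\<Prod>j\<in>U. f j) + q * t * (f x * c + (\<Prod>j\<in>U. f j))]
      (mod q\<^sup>2)" for t
  proof (rule cong_trans[OF cong_scalar_left[OF c]])
    have "(f x + q * t) * ((\<Prod>j\<in>U. f j) + q * t * c) - (f x * (\<Prod>j\<in>U. f j) + q * t * (f x * c + (\<Prod>j\<in>U. f j)))
        = q\<^sup>2 * (t\<^sup>2 * c)"
      by (simp add: algebra_simps power2_eq_square)
    then show "[(f x + q * t) * ((\<Prod>j\<in>U. f j) + q * t * c) = f x * (\<Prod>j\<in>U. f j) + q * t * (f x * c + (\<Prod>j\<in>U. f j))]
        (mod q\<^sup>2)"
      by (simp add: cong_iff_dvd_diff)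
  qed
  with insert show ?case by auto
qed

text \<open>
  Both \<open>t\<close> and \<open>- 1 - t\<close> give the same product, by the reflection \<open>j \<mapsto> p ^ k - j\<close>. As the product
  is affine in \<open>t\<close> modulo \<open>p ^ (2 * k)\<close>, its slope must vanish modulo \<open>p ^ (k + 1)\<close>.
\<close>

lemma unit_block_cong:
  assumes p: "prime p" "odd p" and k: "k \<ge> 1"
  shows "[(\<Prod>j<p ^ k. unit_part p (int j + int p ^ k * t)) = (\<Prod>j<p ^ k. unit_part p (int j))]
    (mod int p ^ (k + 1))"
proof -
  define q where "q = p ^ k"
  define U where "U = {j. j < q \<and> \<not> p dvd j}"
  have fin: "finite U" by (simp add: U_def)
  have pq: "p dvd q" using k by (simp add: q_def)
  have oq: "odd q" using p by (simp add: q_def)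
  have eq: "(\<Prod>j<q. unit_part p (int j + int q * t)) = (\<Prod>j\<in>U. int j + int q * t)" for t
  proof -
    have "int p dvd int j + int q * t \<longleftrightarrow> p dvd j" for j
      using pq by (simp add: dvd_add_left_iff)
    then have "(\<Prod>j<q. unit_part p (int j + int q * t)) = (\<Prod>j<q. if \<not> p dvd j then int j + int q * t else 1)"
      by (intro prod.cong) (auto simp: unit_part_def)
    also have "\<dots> = (\<Prod>j\<in>U. int j + int q * t)"
      by (subst prod.inter_filter [symmetric]) (simp_all add: U_def)
    finally show ?thesis .
  qed
  have refl: "q - j \<in> U" if "j \<in> U" for j
  proof -
    have "j > 0" using that by (auto simp: U_def intro: Nat.gr0I)
    moreover have "\<not> p dvd q - j"
      using that pq dvd_diffD1[of p q j] by (auto simp: U_def)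
    ultimately show ?thesis using that by (auto simp: U_def)
  qed
  have bij: "bij_betw (\<lambda>j. q - j) U U"
    by (rule bij_betwI[where g = "\<lambda>j. q - j"]) (auto simp: refl, auto simp: U_def)
  \<comment> \<open>The reflection has no fixed point because \<open>q\<close> is odd, so
    \<open>U\<close> consists of its lower half \<open>L\<close> and the mirror image of
    \<open>L\<close>. Evenness removes the sign that the reflection produces in
    \<open>reflP\<close>.\<close>
  have even: "even (card U)"
  proof -
    define L where "L = {j \<in> U. 2 * j < q}"
    have "U = L \<union> (\<lambda>j. q - j) ` L"
    proof -
      have "j \<in> L \<or> j \<in> (\<lambda>j. q - j) ` L" if "j \<in> U" for j
      proof (cases "2 * j < q")
        case False
        moreover have "2 * j \<noteq> q" using oq by auto
        moreover have "j < q" using that by (simp add: U_def)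
        ultimately have "2 * (q - j) < q" by linarith
        then have "q - j \<in> L" using refl[OF that] by (simp add: L_def)
        moreover have "j = q - (q - j)" using that by (simp add: U_def)
        ultimately show ?thesis by blast
      qed (use that in \<open>simp add: L_def\<close>)
      then show ?thesis using refl by (auto simp: L_def)
    qed
    moreover have "L \<inter> (\<lambda>j. q - j) ` L = {}"
    proof -
      have "2 * (q - j) \<ge> q" if "2 * j < q" for j :: nat
        using that by linarith
      then show ?thesis by (force simp: L_def)
    qed
    moreover have "card ((\<lambda>j. q - j) ` L) = card L"
      by (rule card_image, rule inj_on_subset[of _ U]) (use bij in \<open>auto simp: bij_betw_def L_def\<close>)
    moreover have "finite L"
      using fin by (simp add: L_def)
    ultimately have "card U = card L + card L"
      by (simp add: card_Un_disjoint)
    then show ?thesis by simp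
  qed
  define P where "P t = (\<Prod>j\<in>U. int j + int q * t)" for t
  have reflP: "P (- 1) = P 0"
  proof -
    have "P (- 1) = (\<Prod>j\<in>U. - int (q - j))"
      unfolding P_def by (rule prod.cong) (auto simp: U_def)
    also have "\<dots> = (- 1) ^ card U * (\<Prod>j\<in>U. int (q - j))"
      by (rule prod_uminus)
    also have "(\<Prod>j\<in>U. int (q - j)) = (\<Prod>j\<in>U. int j)"
      by (rule prod.reindex_bij_betw[OF bij])
    finally show ?thesis using even by (simp add: P_def)
  qed
  obtain c where "[(\<Prod>j\<in>U. int j + int q * t) = (\<Prod>j\<in>U. int j) + int q * t * c] (mod (int q)\<^sup>2)" for t
    using prod_add_cong_linear[OF fin, of int "int q"] by blast
  moreover have "int p ^ (k + 1) dvd int p ^ (k * 2)"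
    by (rule le_imp_power_dvd) (use k in simp)
  then have "int p ^ (k + 1) dvd (int q)\<^sup>2"
    by (simp add: q_def flip: power_mult)
  ultimately have c: "[P t = P 0 + int q * t * c] (mod int p ^ (k + 1))" for t
    unfolding P_def by (auto intro: cong_dvd_modulus)
  from c[of "- 1"] have "int p ^ (k + 1) dvd int q * c"
    unfolding reflP by (simp add: cong_iff_dvd_diff)
  then have "[P 0 + int q * t * c = P 0] (mod int p ^ (k + 1))"
    using dvd_mult2[of _ "int q * c" t] by (simp add: cong_iff_dvd_diff mult_ac)
  with c[of t] have "[P t = P 0] (mod int p ^ (k + 1))"
    by (rule cong_trans)
  then show ?thesis
    using eq[of t] eq[of 0] by (simp add: P_def q_def)
qed

text \<open>When \<open>a - b\<close> is split off from \<open>a ^ p - b ^ p\<close>, the cofactor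
  is congruent to \<open>p * b ^ (p - 1)\<close> modulo \<open>p\<close> and so supplies one more
  factor \<open>p\<close>.\<close>

lemma cong_power_prime:
  fixes a b :: int
  assumes "[a = b] (mod int p ^ k)" "k \<ge> 1"
  shows "[a ^ p = b ^ p] (mod int p ^ (k + 1))"
proof -
  have "[a = b] (mod int p)"
    using assms by (metis Suc_le_D One_nat_def cong_dvd_modulus dvd_triv_left power_Suc)
  then have "[(\<Sum>i<p. b ^ (p - Suc i) * a ^ i) = (\<Sum>i<p. b ^ (p - Suc i) * b ^ i)] (mod int p)"
    by (intro cong_sum cong_mult cong_pow cong_refl)
  also have "(\<Sum>i<p. b ^ (p - Suc i) * b ^ i) = (\<Sum>i<p. b ^ (p - 1))"
    by (rule sum.cong) (auto simp flip: power_add)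
  finally have "int p dvd (\<Sum>i<p. b ^ (p - Suc i) * a ^ i)"
    by (simp add: cong_dvd_iff)
  moreover have "int p ^ k dvd a - b"
    using assms by (simp add: cong_iff_dvd_diff)
  ultimately have "int p ^ k * int p dvd (a - b) * (\<Sum>i<p. b ^ (p - Suc i) * a ^ i)"
    by (rule mult_dvd_mono[rotated])
  then show ?thesis
    by (simp add: cong_iff_dvd_diff power_diff_sumr2 mult.commute)
qed

text \<open>\<open>unit_part\<close> keeps each multiple of \<open>p\<close> as a factor 1 instead
  of omitting it, so the range can be cut into blocks of length \<open>p ^ k\<close>, all with the
  same product by \<open>unit_block_cong\<close>. The modulus is \<open>p\<close> times the block
  length; \<open>wilson_prime_power\<close> and \<open>morita_nat_mod_square\<close> both live on
  this gain.\<close>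

lemma prod_unit_part_blocks:
  assumes p: "prime p" "odd p" and k: "k \<ge> 1"
  shows "[(\<Prod>j<n * p ^ k. unit_part p (int j)) = (\<Prod>j<p ^ k. unit_part p (int j)) ^ n]
    (mod int p ^ (k + 1))"
proof -
  have "(\<Prod>j<n * p ^ k. unit_part p (int j))
      = (\<Prod>m<n. \<Prod>j\<in>{m * p ^ k..<m * p ^ k + p ^ k}. unit_part p (int j))"
    by (rule prod.nat_group[symmetric])
  also have "\<dots> = (\<Prod>m<n. \<Prod>j<p ^ k. unit_part p (int j + int p ^ k * int m))"
  proof (rule prod.cong)
    fix m
    show "(\<Prod>j\<in>{m * p ^ k..<m * p ^ k + p ^ k}. unit_part p (int j))
        = (\<Prod>j<p ^ k. unit_part p (int j + int p ^ k * int m))"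
      by (rule prod.reindex_bij_witness[of _ "\<lambda>j. j + m * p ^ k" "\<lambda>j. j - m * p ^ k"])
        (auto simp: mult.commute)
  qed simp
  finally have eq: "(\<Prod>j<n * p ^ k. unit_part p (int j))
      = (\<Prod>m<n. \<Prod>j<p ^ k. unit_part p (int j + int p ^ k * int m))" .
  have "[(\<Prod>m<n. \<Prod>j<p ^ k. unit_part p (int j + int p ^ k * int m))
      = (\<Prod>m<n. \<Prod>j<p ^ k. unit_part p (int j))] (mod int p ^ (k + 1))"
    by (intro cong_prod unit_block_cong assms)
  then show ?thesis by (simp add: eq)
qed

lemma prod_unit_part_fact:
  assumes "prime p"
  shows "(\<Prod>j<p. unit_part p (int j)) = fact (p - 1)"
proof -
  have "(\<Prod>j<p. unit_part p (int j)) = (\<Prod>j\<in>{1..p - 1}. int j)"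
  proof (rule prod.mono_neutral_cong_right)
    have "{..<p} - {1..p - 1} \<subseteq> {0}" by auto
    then show "\<forall>i\<in>{..<p} - {1..p - 1}. unit_part p (int i) = 1"
      by (auto simp: unit_part_def)
    show "unit_part p (int x) = int x" if "x \<in> {1..p - 1}" for x
      using that by (auto simp: unit_part_def dest: dvd_imp_le)
  qed (use assms prime_gt_0_nat in auto)
  then show ?thesis by (simp add: fact_prod)
qed

text \<open>The block of length \<open>p ^ (k + 1)\<close> is the \<open>p\<close>-th power of the
  block of length \<open>p ^ k\<close>, and taking \<open>p\<close>-th powers lifts the congruence
  to \<open>- 1\<close> by one power of \<open>p\<close>. Oddness of \<open>p\<close> keeps the
  value at \<open>- 1\<close>.\<close>

lemma wilson_prime_power:
  assumes p: "prime p" "odd p" and k: "k \<ge> 1"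
  shows "[(\<Prod>j<p ^ k. unit_part p (int j)) = - 1] (mod int p ^ k)"
  using k
proof (induction k rule: dec_induct)
  case base
  have "[fact (p - 1) = (- 1 :: int)] (mod int p)"
    using p wilson_theorem by blast
  then show ?case by (simp add: prod_unit_part_fact p)
next
  case (step k)
  have "[(\<Prod>j<p * p ^ k. unit_part p (int j)) = (\<Prod>j<p ^ k. unit_part p (int j)) ^ p] (mod int p ^ (k + 1))"
    using step by (intro prod_unit_part_blocks p)
  also have "[(\<Prod>j<p ^ k. unit_part p (int j)) ^ p = (- 1) ^ p] (mod int p ^ (k + 1))"
    using step by (intro cong_power_prime)
  finally show ?case using p by simp
qed


section \<open>Morita's gamma function on the natural numbers\<close>

definition morita_nat :: "nat \<Rightarrow> nat \<Rightarrow> int"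
  where "morita_nat p n = (- 1) ^ n * (\<Prod>j<n. unit_part p (int j))"

lemma morita_nat_0 [simp]: "morita_nat p 0 = 1"
  by (simp add: morita_nat_def)

lemma morita_nat_Suc: "morita_nat p (Suc n) = - unit_part p (int n) * morita_nat p n"
  by (simp add: morita_nat_def)

lemma morita_nat_altdef:
  "morita_nat p n = (- 1) ^ n * (\<Prod>j\<in>{j. 1 \<le> j \<and> j < n \<and> \<not> p dvd j}. int j)"
proof -
  have "(\<Prod>j<n. unit_part p (int j)) = (\<Prod>j\<in>{j. 1 \<le> j \<and> j < n \<and> \<not> p dvd j}. int j)"
    by (rule prod.mono_neutral_cong_right) (auto simp: unit_part_def Suc_le_eq intro: Nat.gr0I)
  then show ?thesis by (simp add: morita_nat_def)
qed

lemma not_dvd_unit_part: "prime p \<Longrightarrow> \<not> int p dvd unit_part p x"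
  using prime_gt_1_nat[of p] by (auto simp: unit_part_def)

lemma not_dvd_morita_nat: "prime p \<Longrightarrow> \<not> int p dvd morita_nat p n"
proof (induction n)
  case 0
  then show ?case using prime_gt_1_nat[of p] by auto
next
  case (Suc n)
  then show ?case by (simp add: morita_nat_Suc prime_dvd_mult_iff not_dvd_unit_part)
qed

text \<open>At \<open>n = 0\<close> the value \<open>- 1\<close> of a full block cancels the sign
  \<open>(- 1) ^ (p ^ k)\<close>. From there the recurrence, whose factors are periodic modulo
  \<open>p ^ k\<close>, carries the congruence to all \<open>n\<close>.\<close>

lemma morita_nat_add_prime_power:
  assumes p: "prime p" "odd p"
  shows "[morita_nat p (n + p ^ k) = morita_nat p n] (mod int p ^ k)"
proof (cases "k = 0")
  case False
  show ?thesis
  proof (induction n)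
    case 0
    have "[- (\<Prod>j<p ^ k. unit_part p (int j)) = - (- 1)] (mod int p ^ k)"
      using wilson_prime_power[OF p, of k] False by (subst cong_minus_minus_iff) simp
    then show ?case using p by (simp add: morita_nat_def)
  next
    case (Suc n)
    moreover have "[unit_part p (int n + int p ^ k) = unit_part p (int n)] (mod int p ^ k)"
      by (rule unit_part_cong) (simp add: cong_def)
    ultimately show ?case
      by (simp add: morita_nat_Suc cong_minus_minus_iff cong_mult)
  qed
qed auto

text \<open>This is the p-adic continuity on the natural numbers, in the strong form that
  congruences modulo every power of \<open>p\<close> are preserved. The extension
  \<open>gamma_padic_int\<close> rests on it.\<close>

lemma morita_nat_cong:
  assumes p: "prime p" "odd p" and "[m = n] (mod p ^ k)"
  shows "[morita_nat p m = morita_nat p n] (mod int p ^ k)"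
proof -
  have mult: "[morita_nat p (n + i * p ^ k) = morita_nat p n] (mod int p ^ k)" for n i
  proof (induction i)
    case (Suc i)
    have "[morita_nat p (n + i * p ^ k + p ^ k) = morita_nat p (n + i * p ^ k)] (mod int p ^ k)"
      by (rule morita_nat_add_prime_power[OF p])
    with Suc show ?case by (simp add: add_ac cong_trans)
  qed simp
  have red: "[morita_nat p n = morita_nat p (n mod p ^ k)] (mod int p ^ k)" for n
    using mult[of "n mod p ^ k" "n div p ^ k"] by (simp add: mod_mult_div_eq add.commute mult.commute)
  moreover have "m mod p ^ k = n mod p ^ k"
    using assms by (simp add: cong_def)
  ultimately show ?thesis
    using red[of m] cong_sym[OF red[of n]] by (metis cong_trans)
qed

section \<open>Morita's function modulo the square of \<open>p\<close>\<close>

lemma cong_one_add_power: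
  fixes q c :: int
  shows "[(1 + q * c) ^ n = 1 + q * c * int n] (mod q\<^sup>2)"
proof (induction n)
  case (Suc n)
  have "[(1 + q * c) * (1 + q * c) ^ n = (1 + q * c) * (1 + q * c * int n)] (mod q\<^sup>2)"
    by (rule cong_scalar_left[OF Suc])
  also have "[(1 + q * c) * (1 + q * c * int n) = 1 + q * c * int (Suc n)] (mod q\<^sup>2)"
  proof -
    have "(1 + q * c) * (1 + q * c * int n) - (1 + q * c * int (Suc n)) = q\<^sup>2 * (c\<^sup>2 * int n)"
      by (simp add: algebra_simps power2_eq_square)
    then show ?thesis by (simp add: cong_iff_dvd_diff)
  qed
  finally show ?case by simp
qed simp

text \<open>The first \<open>p * n\<close> factors form \<open>n\<close> blocks, each congruent to
  \<open>B = (p - 1)!\<close> modulo \<open>p ^ 2\<close>. As \<open>p\<close> is odd, the sign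
  turns \<open>B ^ n\<close> into \<open>(- B) ^ n\<close>, and \<open>- B = 1 + p * w\<close> by
  Wilson's theorem, so \<open>w\<close> is minus the Wilson quotient and does not depend on
  \<open>n\<close> or \<open>r\<close>. Of the \<open>r\<close> remaining factors only the first, at
  the multiple \<open>p * n\<close>, is replaced by 1.\<close>

lemma morita_nat_mod_square:
  assumes p: "prime p" "odd p"
  obtains w where "\<And>n r. r < p \<Longrightarrow> [morita_nat p (r + p * n)
    = (1 + int p * w * int n) * ((- 1) ^ r * (\<Prod>j\<in>{1..<r}. int j + int p * int n))] (mod (int p)\<^sup>2)"
proof -
  define B where "B = (\<Prod>j<p. unit_part p (int j))"
  have "[B = - 1] (mod int p)"
    using wilson_prime_power[OF p, of 1] by (simp add: B_def)
  then obtain c where c: "B + 1 = int p * c"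
    by (auto simp: cong_iff_dvd_diff)
  define w where "w = - c"
  have w: "- B = 1 + int p * w"
    using c by (simp add: w_def)
  show ?thesis
  proof (rule that)
    fix n r assume r: "r < p"
    define P where "P = (- 1) ^ r * (\<Prod>j\<in>{1..<r}. int j + int p * int n)"
    have "(\<Prod>j<r + p * n. unit_part p (int j))
        = (\<Prod>j<p * n. unit_part p (int j)) * (\<Prod>j\<in>{p * n..<p * n + r}. unit_part p (int j))"
      by (subst prod.union_disjoint[symmetric]) (auto intro!: prod.cong)
    also have "(\<Prod>j\<in>{p * n..<p * n + r}. unit_part p (int j)) = (\<Prod>j<r. unit_part p (int j + int p * int n))"
      by (rule prod.reindex_bij_witness[of _ "\<lambda>j. j + p * n" "\<lambda>j. j - p * n"]) auto
    also have "\<dots> = (\<Prod>j\<in>{1..<r}. int j + int p * int n)"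
    proof (rule prod.mono_neutral_cong_right)
      have "{..<r} - {1..<r} \<subseteq> {0}" by auto
      then show "\<forall>i\<in>{..<r} - {1..<r}. unit_part p (int i + int p * int n) = 1"
        by (auto simp: unit_part_def)
      show "unit_part p (int x + int p * int n) = int x + int p * int n" if "x \<in> {1..<r}" for x
        using that r by (auto simp: unit_part_def dvd_add_left_iff dest: dvd_imp_le)
    qed auto
    finally have split: "(\<Prod>j<r + p * n. unit_part p (int j))
        = (\<Prod>j<p * n. unit_part p (int j)) * (\<Prod>j\<in>{1..<r}. int j + int p * int n)" .
    have sign: "(- 1 :: int) ^ (r + p * n) = (- 1) ^ n * (- 1) ^ r"
      using p by (simp add: minus_one_power_iff)
    have "morita_nat p (r + p * n) = (- 1) ^ n * (\<Prod>j<n * p ^ 1. unit_part p (int j)) * P"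
      unfolding morita_nat_def P_def sign split by (simp add: mult_ac)
    also have "[(- 1) ^ n * (\<Prod>j<n * p ^ 1. unit_part p (int j)) * P = (- 1) ^ n * B ^ n * P] (mod int p ^ (1 + 1))"
      using prod_unit_part_blocks[OF p, of 1 n] by (intro cong_mult cong_refl) (simp add: B_def)
    also have "(- 1) ^ n * B ^ n = (1 + int p * w) ^ n"
      by (simp flip: w power_mult_distrib)
    also have "[(1 + int p * w) ^ n * P = (1 + int p * w * int n) * P] (mod int p ^ (1 + 1))"
      using cong_one_add_power[of "int p" w n] by (intro cong_mult cong_refl) (simp add: power2_eq_square)
    finally show "[morita_nat p (r + p * n) = (1 + int p * w * int n) * P] (mod (int p)\<^sup>2)"
      by (simp add: power2_eq_square)
  qed
qed

section \<open>The p-adic gamma function\<close>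

lemma prime_CARD_prime_card: "prime CARD('p::prime_card)"
  by (rule prime_card)

lemma Rep_padic_int_mod_self [simp]: "Rep_padic_int x n mod int CARD('p) ^ n = Rep_padic_int x n"
  for x :: "'p::prime_card padic_int"
  using Rep_padic_int_mod[of x n 0] by simp

lemma Rep_padic_int_nonneg [simp]: "0 \<le> Rep_padic_int x n"
  for x :: "'p::prime_card padic_int"
proof -
  have "0 \<le> Rep_padic_int x n mod int CARD('p) ^ n"
    using CARD_prime_card_gt_1[where 'p = 'p] by (intro pos_mod_sign) simp
  then show ?thesis by simp
qed

lemma Rep_padic_int_less: "Rep_padic_int x n < int CARD('p) ^ n"
  for x :: "'p::prime_card padic_int"
proof -
  have "Rep_padic_int x n mod int CARD('p) ^ n < int CARD('p) ^ n"
    using CARD_prime_card_gt_1[where 'p = 'p] by (intro pos_mod_bound) simp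
  then show ?thesis by simp
qed

lemma Rep_padic_int_uminus: "Rep_padic_int (- x) n = (- Rep_padic_int x n) mod int CARD('p) ^ n"
  for x :: "'p::prime_card padic_int"
  by (simp add: uminus_padic_int.rep_eq)

lemma Rep_padic_int_of_int:
  "Rep_padic_int (of_int z :: 'p::prime_card padic_int) n = z mod int CARD('p) ^ n"
  by (cases z rule: int_cases2) (simp_all add: Rep_padic_int_of_nat Rep_padic_int_uminus mod_minus_eq)

lemma padic_int_power_dvd_diff_iff:
  "of_nat CARD('p) ^ k dvd x - y \<longleftrightarrow> Rep_padic_int x k = Rep_padic_int y k"
  for x y :: "'p::prime_card padic_int"
proof -
  have "Rep_padic_int (x + - y) k = (Rep_padic_int x k - Rep_padic_int y k) mod int CARD('p) ^ k"
    unfolding Rep_padic_int_add Rep_padic_int_uminus by (simp add: mod_add_right_eq)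
  then have "Rep_padic_int (x - y) k = 0 \<longleftrightarrow> [Rep_padic_int x k = Rep_padic_int y k] (mod int CARD('p) ^ k)"
    by (simp add: cong_iff_dvd_diff dvd_eq_mod_eq_0)
  then show ?thesis
    by (simp add: padic_int_power_dvd_iff cong_def)
qed

text \<open>The entry modulo \<open>p ^ n\<close> is Morita's value at the representative of
  \<open>x\<close> modulo \<open>p ^ n\<close>. Coherence of these entries comes from
  \<open>morita_nat_cong\<close>, which is stated for odd primes; hence the context below.\<close>

definition gamma_padic_int :: "'p::prime_card padic_int \<Rightarrow> 'p padic_int"
  where "gamma_padic_int x =
    Abs_padic_int (\<lambda>n. morita_nat CARD('p) (nat (Rep_padic_int x n)) mod int CARD('p) ^ n)"

context
  assumes odd_CARD: "odd CARD('p::prime_card)"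
begin

lemma Rep_gamma_padic_int:
  "Rep_padic_int (gamma_padic_int x) n = morita_nat CARD('p) (nat (Rep_padic_int x n)) mod int CARD('p) ^ n"
  for x :: "'p padic_int"
proof -
  have "morita_nat CARD('p) (nat (Rep_padic_int x (Suc n))) mod int CARD('p) ^ Suc n mod int CARD('p) ^ n
      = morita_nat CARD('p) (nat (Rep_padic_int x n)) mod int CARD('p) ^ n" for n
  proof -
    have "[int (nat (Rep_padic_int x (Suc n))) = int (nat (Rep_padic_int x n))] (mod int (CARD('p) ^ n))"
      using Rep_padic_int_mod[of x n 1] by (simp add: cong_def)
    then have "[nat (Rep_padic_int x (Suc n)) = nat (Rep_padic_int x n)] (mod CARD('p) ^ n)"
      by (simp only: cong_int_iff)
    from morita_nat_cong[OF prime_CARD_prime_card odd_CARD this] show ?thesis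
      by (simp add: cong_def mod_mod_cancel)
  qed
  then show ?thesis
    unfolding gamma_padic_int_def by (subst Abs_padic_int_inverse) auto
qed

lemma Rep_gamma_padic_int_cong:
  fixes x :: "'p padic_int"
  assumes "[int m = Rep_padic_int x n] (mod int CARD('p) ^ n)"
  shows "Rep_padic_int (gamma_padic_int x) n = morita_nat CARD('p) m mod int CARD('p) ^ n"
proof -
  have "[int m = int (nat (Rep_padic_int x n))] (mod int (CARD('p) ^ n))"
    using assms by simp
  then have "[m = nat (Rep_padic_int x n)] (mod CARD('p) ^ n)"
    by (simp only: cong_int_iff)
  from morita_nat_cong[OF prime_CARD_prime_card odd_CARD this] show ?thesis
    by (simp add: Rep_gamma_padic_int cong_def)
qed

lemma gamma_padic_int_of_nat: "gamma_padic_int (of_nat n :: 'p padic_int) = of_int (morita_nat CARD('p) n)"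
proof (rule padic_int_eqI)
  fix k
  show "Rep_padic_int (gamma_padic_int (of_nat n :: 'p padic_int)) k
      = Rep_padic_int (of_int (morita_nat CARD('p) n) :: 'p padic_int) k"
    by (subst Rep_gamma_padic_int_cong[of n])
      (simp_all add: Rep_padic_int_of_nat Rep_padic_int_of_int cong_def)
qed

lemma gamma_padic_int_cong:
  fixes x y :: "'p padic_int"
  assumes "of_nat CARD('p) ^ k dvd x - y"
  shows "of_nat CARD('p) ^ k dvd gamma_padic_int x - gamma_padic_int y"
  using assms by (simp add: padic_int_power_dvd_diff_iff Rep_gamma_padic_int)

lemma gamma_padic_int_add_1:
  fixes x :: "'p padic_int"
  shows "gamma_padic_int (x + 1) = (if of_nat CARD('p) dvd x then - 1 else - x) * gamma_padic_int x"
proof (rule padic_int_eqI)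
  fix n
  show "Rep_padic_int (gamma_padic_int (x + 1)) n
      = Rep_padic_int ((if of_nat CARD('p) dvd x then - 1 else - x) * gamma_padic_int x) n"
  proof (cases n)
    \<comment> \<open>Divisibility of \<open>x\<close> by \<open>p\<close> can be read off its
      \<open>n\<close>-th entry only for \<open>n \<ge> 1\<close>; modulo \<open>p ^ 0\<close> every
      entry is 0.\<close>
    case 0
    have "Rep_padic_int y 0 = 0" for y :: "'p padic_int"
      using Rep_padic_int_mod_self[of y 0] by simp
    with 0 show ?thesis by simp
  next
    case (Suc l)
    define m where "m = nat (Rep_padic_int x n)"
    have m: "Rep_padic_int x n = int m"
      by (simp add: m_def)
    have "of_nat CARD('p) dvd x \<longleftrightarrow> Rep_padic_int x 1 = 0"
      using padic_int_power_dvd_iff[of 1 x] by simp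
    also have "\<dots> \<longleftrightarrow> int CARD('p) dvd int m"
      using Rep_padic_int_mod[of x 1 l] Suc m by (simp add: dvd_eq_mod_eq_0)
    finally have dvd: "of_nat CARD('p) dvd x \<longleftrightarrow> int CARD('p) dvd int m" .
    have "Rep_padic_int (gamma_padic_int (x + 1)) n = morita_nat CARD('p) (Suc m) mod int CARD('p) ^ n"
      by (rule Rep_gamma_padic_int_cong)
        (simp add: Rep_padic_int_add Rep_padic_int_1 m cong_def mod_add_right_eq add.commute)
    also have "\<dots> = - unit_part CARD('p) (int m) * morita_nat CARD('p) m mod int CARD('p) ^ n"
      by (simp add: morita_nat_Suc)
    also have "\<dots> = Rep_padic_int ((if of_nat CARD('p) dvd x then - 1 else - x) * gamma_padic_int x) n"
      unfolding dvd unit_part_def if_distrib[of "\<lambda>x. x * _"] if_distrib[of uminus]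
        if_distrib[of "\<lambda>x. Rep_padic_int x _"] if_distrib[of "\<lambda>x. x mod _"]
        mult_minus_left mult_1_left Rep_padic_int_uminus Rep_padic_int_mult Rep_gamma_padic_int m nat_int
        mod_mult_right_eq mod_minus_eq by (rule refl)
    finally show ?thesis .
  qed
qed

end

section \<open>Congruence and distance, and the identification of \<open>padic_Gamma\<close>\<close>

lemma of_padic_int_of_int [simp]: "of_padic_int (of_int z) = of_int z"
  by (cases z rule: int_cases2) simp_all

lemma padic_intsE:
  assumes "x \<in> padic_ints"
  obtains a where "x = of_padic_int a"
  using assms by (auto simp: padic_ints_def)

lemma padic_cong_of_padic_int:
  "padic_cong k (of_padic_int x) (of_padic_int y) \<longleftrightarrow> of_nat CARD('p) ^ k dvd x - y"
  for x y :: "'p::prime_card padic_int"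
proof -
  have "of_padic_int x - of_padic_int y = of_nat CARD('p) ^ k * (of_padic_int z :: 'p padic)
      \<longleftrightarrow> x - y = of_nat CARD('p) ^ k * z" for z
    by (simp only: of_padic_int_eq_iff flip: of_padic_int_hom(4,6) of_padic_int_of_nat of_padic_int_power)
  then show ?thesis
    by (auto simp: padic_cong_def padic_ints_def dvd_def image_iff)
qed

lemma padic_cong_iff_divide: "padic_cong k x y \<longleftrightarrow> (x - y) / of_nat CARD('p) ^ k \<in> padic_ints"
  for x y :: "'p::prime_card padic"
proof
  assume "padic_cong k x y"
  then show "(x - y) / of_nat CARD('p) ^ k \<in> padic_ints"
    by (auto simp: padic_cong_def)
next
  assume "(x - y) / of_nat CARD('p) ^ k \<in> padic_ints"
  then show "padic_cong k x y"
    unfolding padic_cong_def by (rule rev_image_eqI) simp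
qed

text \<open>A distance of at most \<open>p\<close> to the power \<open>- k\<close> means a valuation
  of at least \<open>k\<close>. This dictionary turns the continuity in the definition of
  \<open>padic_Gamma\<close> into congruences.\<close>

lemma padic_cong_iff_dist: "padic_cong k x y \<longleftrightarrow> dist x y \<le> 1 / real CARD('p) ^ k"
  for x y :: "'p::prime_card padic"
proof (cases "x = y")
  case False
  have "dist x y = real CARD('p) powi (- padic_val (x - y))"
    using False by (simp add: dist_padic_def padic_abs_def)
  then have "dist x y \<le> 1 / real CARD('p) ^ k \<longleftrightarrow> real CARD('p) powi (- padic_val (x - y)) \<le> real CARD('p) powi (- int k)"
    by (simp add: power_int_minus divide_inverse)
  also have "\<dots> \<longleftrightarrow> - padic_val (x - y) \<le> - int k"
  proof -
    have "1 < real CARD('p)" using CARD_prime_card_gt_1[where 'p = 'p] by simp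
    then show ?thesis
      using power_int_increasing[of "- padic_val (x - y)" "- int k" "real CARD('p)"]
        power_int_strict_increasing[of "- int k" "- padic_val (x - y)" "real CARD('p)"] by linarith
  qed
  also have "\<dots> \<longleftrightarrow> padic_cong k x y"
    using padic_in_power_iff[of "x - y" "int k"] False by (simp add: padic_cong_iff_divide)
  finally show ?thesis ..
qed (simp add: padic_cong_def)

lemma padic_ints_dense_nat:
  fixes x :: "'p::prime_card padic"
  assumes "x \<in> padic_ints"
  obtains n where "padic_cong k (of_nat n) x"
proof -
  obtain a where a: "x = of_padic_int a" using assms by (rule padic_intsE)
  have "padic_cong k (of_padic_int (of_nat (nat (Rep_padic_int a k)))) x"
    (is "padic_cong k (of_padic_int (of_nat ?n)) x")
    unfolding a padic_cong_of_padic_int padic_int_power_dvd_diff_iff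
    by (simp only: Rep_padic_int_of_nat) simp
  then show ?thesis by (intro that[of ?n]) (simp only: of_padic_int_of_nat)
qed

text \<open>To resolve the definite description, \<open>F\<close> is shown to be its only solution.
  \<open>F\<close> is continuous because it preserves congruences modulo every \<open>p ^ k\<close>;
  any other solution agrees with it on the natural numbers, which are dense, and hence on all p-adic
  integers.\<close>

lemma padic_Gamma_of_padic_int:
  fixes a :: "'p::prime_card padic_int"
  assumes odd: "odd CARD('p)"
  shows "padic_Gamma (of_padic_int a) = of_padic_int (gamma_padic_int a)"
proof -
  define F :: "'p padic \<Rightarrow> 'p padic"
    where "F x = (if x \<in> padic_ints then of_padic_int (gamma_padic_int (THE a. x = of_padic_int a)) else 0)" for x
  have F: "F (of_padic_int a) = of_padic_int (gamma_padic_int a)" for a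
    by (simp add: F_def)
  have Fcong: "padic_cong k (F x) (F y)" if "x \<in> padic_ints" "y \<in> padic_ints" "padic_cong k x y" for k x y
    using that by (elim padic_intsE) (simp add: F padic_cong_of_padic_int gamma_padic_int_cong odd)
  have small: "\<exists>k. 1 / real CARD('p) ^ k < e" if "e > 0" for e
    using CARD_prime_card_gt_1[where 'p = 'p] that real_arch_pow_inv[of e "1 / real CARD('p)"]
    by (simp add: power_one_over)
  have "continuous_on padic_ints F"
  proof (unfold continuous_on_def, intro ballI tendstoI)
    fix x :: "'p padic" and e :: real assume x: "x \<in> padic_ints" and "e > 0"
    then obtain k where k: "1 / real CARD('p) ^ k < e" using small by blast
    show "eventually (\<lambda>x'. dist (F x') (F x) < e) (at x within padic_ints)"
      unfolding eventually_at
    proof (intro exI[of _ "1 / real CARD('p) ^ k"] conjI ballI impI)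
      fix x' :: "'p padic" assume "x' \<in> padic_ints" "x' \<noteq> x \<and> dist x' x < 1 / real CARD('p) ^ k"
      then have "padic_cong k (F x') (F x)"
        using x by (intro Fcong) (simp_all add: padic_cong_iff_dist)
      with k show "dist (F x') (F x) < e" by (simp add: padic_cong_iff_dist)
    qed simp
  qed
  moreover have Fnat: "F (of_nat n) = of_int (morita_nat CARD('p) n)" for n
    using F[of "of_nat n"] by (simp add: gamma_padic_int_of_nat odd)
  then have Fnat': "F (of_nat n) = (- 1) ^ n * (\<Prod>j\<in>{j. 1 \<le> j \<and> j < n \<and> \<not> CARD('p) dvd j}. of_nat j)" for n
    by (simp add: morita_nat_altdef)
  moreover have "F 0 = 1" using Fnat[of 0] by simp
  moreover have "\<forall>x. x \<notin> padic_ints \<longrightarrow> F x = 0" by (simp add: F_def)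
  moreover have "f = F"
    if cont: "continuous_on padic_ints f" and f0: "f 0 = 1"
      and fn: "\<forall>n\<ge>1. f (of_nat n) = (- 1) ^ n * (\<Prod>j\<in>{j. 1 \<le> j \<and> j < n \<and> \<not> CARD('p) dvd j}. of_nat j)"
      and out: "\<forall>x. x \<notin> padic_ints \<longrightarrow> f x = 0" for f
  proof
    fix x
    show "f x = F x"
    proof (cases "x \<in> padic_ints")
      case True
      have "\<forall>k. \<exists>n. padic_cong k (of_nat n) x"
        using padic_ints_dense_nat[OF True] by metis
      then obtain u where u: "\<And>k. padic_cong k (of_nat (u k)) x" by metis
      have "(\<lambda>k. 1 / real CARD('p) ^ k) \<longlonglongrightarrow> 0"
        using CARD_prime_card_gt_1[where 'p = 'p] by (intro LIMSEQ_divide_realpow_zero) simp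
      then have "(\<lambda>k. dist (of_nat (u k)) x) \<longlonglongrightarrow> 0"
        by (rule real_tendsto_sandwich[OF _ _ tendsto_const, rotated 2])
          (use u in \<open>simp_all add: padic_cong_iff_dist\<close>)
      then have lim: "(\<lambda>k. of_nat (u k)) \<longlonglongrightarrow> x"
        by (rule tendsto_dist_iff[THEN iffD2])
      have "(\<lambda>k. f (of_nat (u k))) \<longlonglongrightarrow> f x"
        using True by (intro continuous_on_tendsto_compose[OF cont lim]) auto
      moreover have "(\<lambda>k. F (of_nat (u k))) \<longlonglongrightarrow> F x"
        using True by (intro continuous_on_tendsto_compose[OF \<open>continuous_on padic_ints F\<close> lim]) auto
      \<comment> \<open>The product formula is prescribed from \<open>n = 1\<close> on; at
        \<open>n = 0\<close> the condition \<open>f 0 = 1\<close> takes over.\<close>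
      moreover have "f (of_nat n) = F (of_nat n)" for n
        using fn f0 Fnat'[of n] \<open>F 0 = 1\<close> by (cases "n = 0") auto
      ultimately show ?thesis by (simp add: LIMSEQ_unique)
    qed (use out in \<open>simp add: F_def\<close>)
  qed
  ultimately have "padic_Gamma = F"
    unfolding padic_Gamma_def by (intro the_equality) blast+
  then show ?thesis using F[of a] by metis
qed

section \<open>A terminating case of Whipple's theorem\<close>

lemma pochhammer_shift: "x * pochhammer (x + 1) k = pochhammer x k * (x + of_nat k)"
  for x :: "'a::comm_semiring_1"
  by (metis pochhammer_rec pochhammer_Suc)

text \<open>
  Zeilberger's algorithm: the summands of \<open>F n\<close> and \<open>F (n + 2)\<close> are polynomial multiples of the
  common factor \<open>u k\<close>, and the required combination of them has the partial sums \<open>H\<close>, which vanish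
  at \<open>N\<close>.
\<close>

lemma whipple_recurrence:
  fixes b :: "'a::field_char_0" and n N :: nat
  defines "F \<equiv> (\<lambda>n. \<Sum>k\<le>N. pochhammer (- of_nat n) k * pochhammer (1 + of_nat n) k * pochhammer b k
    / (fact k * fact k * pochhammer (2 * b) k))"
  assumes N: "n + 2 \<le> N" and nz: "pochhammer (2 * b) N \<noteq> 0"
  shows "of_nat (n + 2) * (of_nat n + 1 + 2 * b) * F (n + 2) = of_nat (n + 1) * (of_nat n + 2 - 2 * b) * F n"
proof -
  define y :: 'a where "y = of_nat n"
  define w where "w k = pochhammer b k / (fact k * fact k * pochhammer (2 * b) k)" for k
  \<comment> \<open>Of the parameters \<open>- y\<close> and \<open>- y - 2\<close>, and of
    \<open>y + 1\<close> and \<open>y + 3\<close>, \<open>u\<close> takes the smaller one. This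
    makes both summands polynomial multiples of \<open>u k\<close>, up to the constant
    \<open>(y + 1) * (y + 2)\<close>; see \<open>F0\<close> and \<open>F2\<close>.\<close>
  define u where "u k = pochhammer (- y - 2) k * pochhammer (y + 1) k * w k" for k
  \<comment> \<open>The certificate: \<open>y + 2 - k\<close>, \<open>y + 1 + k\<close> and
    \<open>b + k\<close> are, up to sign, the numerator factors of \<open>u (k + 1) / u k\<close>.
    So \<open>H K\<close> is also a polynomial multiple of \<open>u (Suc K)\<close>, and the
    telescoping step below becomes a polynomial identity.\<close>
  define H where "H k = 2 * (2 * y + 3) * (y + 2 - of_nat k) * (y + 1 + of_nat k) * (b + of_nat k) * u k" for k
  \<comment> \<open>\<open>L k * u k\<close> is the summand of the difference of the two sides of
    the recurrence, multiplied by \<open>(y + 1) * (y + 2)\<close>.\<close>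
  define L where "L k = (y + 2) * (y + 1 + 2 * b) * ((y + 1 + of_nat k) * (y + 2 + of_nat k))
    - (y + 1) * (y + 2 - 2 * b) * ((y + 2 - of_nat k) * (y + 1 - of_nat k))" for k
  have y12: "y + 1 \<noteq> 0" "y + 2 \<noteq> 0"
  proof -
    have "y + 1 = of_nat (n + 1)" "y + 2 = of_nat (n + 2)" by (simp_all add: y_def)
    then show "y + 1 \<noteq> 0" "y + 2 \<noteq> 0" by (simp_all only: of_nat_eq_0_iff)
  qed
  have pnz: "2 * b + of_nat k \<noteq> 0" if "k < N" for k
    using nz that by (auto simp: pochhammer_eq_0_iff eq_neg_iff_add_eq_0)
  have pnz': "pochhammer (2 * b) k \<noteq> 0" if "k \<le> N" for k
    using nz that pochhammer_neq_0_mono by blast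
  have sum: "(\<Sum>k\<le>K. L k * u k) = H K" if "K \<le> N" for K
    using that
  proof (induction K)
    case 0
    show ?case by (simp add: L_def H_def u_def algebra_simps)
  next
    case (Suc K)
    have step: "u (Suc K) * (of_nat (Suc K))\<^sup>2 * (2 * b + of_nat K)
        = (of_nat K - y - 2) * (y + 1 + of_nat K) * (b + of_nat K) * u K"
      using pnz[of K] pnz'[of K] Suc.prems
      by (simp add: u_def w_def pochhammer_Suc divide_simps power2_eq_square del: of_nat_Suc)
    have "H K = - 2 * (2 * y + 3) * ((of_nat K - y - 2) * (y + 1 + of_nat K) * (b + of_nat K) * u K)"
      by (simp add: H_def algebra_simps)
    also have "\<dots> = - 2 * (2 * y + 3) * (of_nat K + 1)\<^sup>2 * (2 * b + of_nat K) * u (Suc K)"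
      using step by (simp add: mult_ac add_ac)
    finally have "H K = - 2 * (2 * y + 3) * (of_nat K + 1)\<^sup>2 * (2 * b + of_nat K) * u (Suc K)" .
    moreover have "H (Suc K) - - 2 * (2 * y + 3) * (of_nat K + 1)\<^sup>2 * (2 * b + of_nat K) * u (Suc K)
        = L (Suc K) * u (Suc K)"
      by (simp add: H_def L_def algebra_simps power2_eq_square)
    ultimately have "H (Suc K) - H K = L (Suc K) * u (Suc K)"
      by (simp only:)
    then show ?case using Suc by (simp add: diff_eq_eq add.commute)
  qed
  \<comment> \<open>At \<open>N = n + 2\<close> the factor \<open>y + 2 - N\<close> vanishes; beyond
    that the Pochhammer symbol of \<open>- y - 2\<close> does.\<close>
  have HN: "H N = 0"
  proof (cases "N = n + 2")
    case False
    then have "pochhammer (- of_nat (n + 2) :: 'a) N = 0"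
      using N by (intro pochhammer_of_nat_eq_0_lemma) simp
    moreover have "- of_nat (n + 2) = - y - 2" by (simp add: y_def)
    ultimately have "pochhammer (- y - 2) N = 0" by (simp only:)
    then show ?thesis by (simp add: H_def u_def)
  qed (simp add: H_def y_def)
  have F0: "(y + 1) * (y + 2) * F n = (\<Sum>k\<le>N. (y + 2 - of_nat k) * (y + 1 - of_nat k) * u k)"
    unfolding F_def sum_distrib_left
  proof (rule sum.cong)
    fix k
    have "- y - 2 + 1 = - y - 1" by simp
    then have "(- y - 2) * pochhammer (- y - 1) k = pochhammer (- y - 2) k * (- y - 2 + of_nat k)"
      using pochhammer_shift[of "- y - 2" k] by (simp only:)
    moreover have "(- y - 1) * pochhammer (- y) k = pochhammer (- y - 1) k * (- y - 1 + of_nat k)"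
      using pochhammer_shift[of "- y - 1" k] by simp
    moreover have "(y + 1) * (y + 2) * pochhammer (- y) k = (- y - 2) * ((- y - 1) * pochhammer (- y) k)"
      by (simp add: algebra_simps)
    ultimately have "(y + 1) * (y + 2) * pochhammer (- y) k
        = pochhammer (- y - 2) k * (- y - 2 + of_nat k) * (- y - 1 + of_nat k)"
      by (metis mult.assoc)
    also have "\<dots> = (y + 2 - of_nat k) * (y + 1 - of_nat k) * pochhammer (- y - 2) k"
      by (simp add: algebra_simps)
    finally have "(y + 1) * (y + 2) * pochhammer (- y) k
        = (y + 2 - of_nat k) * (y + 1 - of_nat k) * pochhammer (- y - 2) k" .
    then show "(y + 1) * (y + 2) * (pochhammer (- of_nat n) k * pochhammer (1 + of_nat n) k * pochhammer b k
        / (fact k * fact k * pochhammer (2 * b) k)) = (y + 2 - of_nat k) * (y + 1 - of_nat k) * u k"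
      unfolding u_def w_def y_def[symmetric] by (simp add: add.commute mult_ac)
  qed simp
  have F2: "(y + 1) * (y + 2) * F (n + 2) = (\<Sum>k\<le>N. (y + 1 + of_nat k) * (y + 2 + of_nat k) * u k)"
    unfolding F_def sum_distrib_left
  proof (rule sum.cong)
    fix k
    have e1: "(y + 1) * pochhammer (y + 2) k = pochhammer (y + 1) k * (y + 1 + of_nat k)"
      using pochhammer_shift[of "y + 1" k] by (simp add: add_ac)
    have e2: "(y + 2) * pochhammer (y + 3) k = pochhammer (y + 2) k * (y + 2 + of_nat k)"
      using pochhammer_shift[of "y + 2" k] by (simp add: add_ac)
    have "(y + 1) * (y + 2) * pochhammer (y + 3) k = (y + 1) * pochhammer (y + 2) k * (y + 2 + of_nat k)"
      unfolding mult.assoc e2 ..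
    also have "\<dots> = (y + 1 + of_nat k) * (y + 2 + of_nat k) * pochhammer (y + 1) k"
      unfolding e1 by (simp only: mult_ac)
    finally have main: "(y + 1) * (y + 2) * pochhammer (y + 3) k
        = (y + 1 + of_nat k) * (y + 2 + of_nat k) * pochhammer (y + 1) k" .
    have "1 + of_nat (n + 2) = y + 3" "- of_nat (n + 2) = - y - 2"
      by (simp_all add: y_def)
    then have "(y + 1) * (y + 2) * (pochhammer (- of_nat (n + 2)) k * pochhammer (1 + of_nat (n + 2)) k * pochhammer b k
        / (fact k * fact k * pochhammer (2 * b) k)) = ((y + 1) * (y + 2) * pochhammer (y + 3) k) * (pochhammer (- y - 2) k * w k)"
      by (simp only: w_def times_divide_eq_right mult_ac)
    also have "\<dots> = (y + 1 + of_nat k) * (y + 2 + of_nat k) * u k"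
      unfolding main u_def by (simp only: mult_ac)
    finally show "(y + 1) * (y + 2) * (pochhammer (- of_nat (n + 2)) k * pochhammer (1 + of_nat (n + 2)) k * pochhammer b k
        / (fact k * fact k * pochhammer (2 * b) k)) = (y + 1 + of_nat k) * (y + 2 + of_nat k) * u k" .
  qed simp
  have "(y + 2) * (y + 1 + 2 * b) * ((y + 1) * (y + 2) * F (n + 2))
      - (y + 1) * (y + 2 - 2 * b) * ((y + 1) * (y + 2) * F n) = (\<Sum>k\<le>N. L k * u k)"
  proof -
    have "P * (A * v) - Q * (B * v) = (P * A - Q * B) * v" for P A Q B v :: 'a
      by (simp add: left_diff_distrib mult.assoc)
    then show ?thesis
      unfolding F0 F2 sum_distrib_left L_def sum_subtractf[symmetric] by (simp only:)
  qed
  then have "(y + 1) * (y + 2) * ((y + 2) * (y + 1 + 2 * b) * F (n + 2) - (y + 1) * (y + 2 - 2 * b) * F n) = 0"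
    using sum[of N] HN by (simp add: algebra_simps)
  with y12 have "(y + 2) * (y + 1 + 2 * b) * F (n + 2) = (y + 1) * (y + 2 - 2 * b) * F n"
    by simp
  then show ?thesis by (simp add: y_def add_ac)
qed

text \<open>The recurrence moves in steps of two, so the parity classes separate: even
  \<open>n\<close> start from \<open>F 0 = 1\<close>, odd \<open>n\<close> from
  \<open>F 1 = 1 - 2 * b / (2 * b) = 0\<close>. The upper limit \<open>N\<close> is fixed
  throughout, to match the truncation at \<open>p - 1\<close>; the terms beyond \<open>n\<close>
  vanish.\<close>

lemma whipple_terminating:
  fixes b :: "'a::field_char_0" and n N :: nat
  defines "F \<equiv> (\<lambda>n. \<Sum>k\<le>N. pochhammer (- of_nat n) k * pochhammer (1 + of_nat n) k * pochhammer b k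
    / (fact k * fact k * pochhammer (2 * b) k))"
  assumes N: "n \<le> N" and nz: "pochhammer (2 * b) N \<noteq> 0"
  shows "F n = (if even n then pochhammer (1 / 2) (n div 2) * pochhammer (1 - b) (n div 2)
    / (fact (n div 2) * pochhammer (b + 1 / 2) (n div 2)) else 0)"
  using N
proof (induction n rule: nat_less_induct)
  case (1 n)
  have pnz: "2 * b + of_nat k \<noteq> 0" if "k < N" for k
    using nz that by (auto simp: pochhammer_eq_0_iff eq_neg_iff_add_eq_0)
  consider "n = 0" | "n = 1" | m where "n = m + 2"
    by (metis add_2_eq_Suc' not0_implies_Suc One_nat_def)
  then show ?case
  proof cases
    case 1
    have "F 0 = (\<Sum>k\<in>{0::nat}. 1)"
      unfolding F_def by (rule sum.mono_neutral_cong_right) (auto simp: pochhammer_0_left)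
    with 1 show ?thesis by simp
  next
    case 2
    then have "1 \<le> N" using \<open>n \<le> N\<close> by simp
    have "F 1 = (\<Sum>k\<in>{0, 1::nat}. pochhammer (- of_nat 1) k * pochhammer (1 + of_nat 1) k * pochhammer b k
        / (fact k * fact k * pochhammer (2 * b) k))"
      unfolding F_def
    proof (rule sum.mono_neutral_right)
      show "\<forall>i\<in>{..N} - {0, 1}. pochhammer (- of_nat 1) i * pochhammer (1 + of_nat 1) i * pochhammer b i
          / (fact i * fact i * pochhammer (2 * b) i) = 0"
      proof
        fix i assume "i \<in> {..N} - {0, 1}"
        then have "pochhammer (- of_nat 1 :: 'a) i = 0"
          by (intro pochhammer_of_nat_eq_0_lemma) auto
        then show "pochhammer (- of_nat 1) i * pochhammer (1 + of_nat 1) i * pochhammer b i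
          / (fact i * fact i * pochhammer (2 * b) i) = 0" by simp
      qed
    qed (use \<open>1 \<le> N\<close> in auto)
    also have "\<dots> = 0"
      using pnz[of 0] \<open>1 \<le> N\<close> by simp
    finally show ?thesis using 2 by simp
  next
    case (3 m)
    define j where "j = m div 2"
    have rec: "of_nat (m + 2) * (of_nat m + 1 + 2 * b) * F n = of_nat (m + 1) * (of_nat m + 2 - 2 * b) * F m"
      unfolding 3(1) F_def by (rule whipple_recurrence) (use 1 3 nz in auto)
    have "(of_nat (m + 2) :: 'a) \<noteq> 0"
      by (simp only: of_nat_eq_0_iff)
    \<comment> \<open>From \<open>m + 2 \<le> N\<close> follows \<open>m + 1 < N\<close>, so
      \<open>2 * b + (m + 1)\<close> is one of the factors of
      \<open>pochhammer (2 * b) N\<close>.\<close>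
    then have nz': "(of_nat (m + 2) :: 'a) * (of_nat m + 1 + 2 * b) \<noteq> 0"
      using pnz[of "m + 1"] 1(2) 3 by (simp add: add_ac del: of_nat_add)
    show ?thesis
    proof (cases "even m")
      case False
      then have "F m = 0" using 1 3 by simp
      with rec nz' show ?thesis using False 3 by (simp del: of_nat_add)
    next
      case True
      then have m: "m = 2 * j" by (simp add: j_def)
      have IH: "F m = pochhammer (1 / 2) j * pochhammer (1 - b) j / (fact j * pochhammer (b + 1 / 2) j)"
        using 1 3 True by (simp add: j_def)
      have eqs: "of_nat (m + 2) = 2 * (of_nat (Suc j) :: 'a)" "of_nat m + 1 + 2 * b = 2 * (b + 1 / 2 + of_nat j)"
        "of_nat (m + 1) = 2 * (1 / 2 + of_nat j :: 'a)" "of_nat m + 2 - 2 * b = 2 * (1 - b + of_nat j)"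
        by (simp_all add: m field_simps)
      have cancel: "X * Y * f = Z * W * g \<and> X * Y \<noteq> 0"
        if "2 * X * (2 * Y) * f = 2 * Z * (2 * W) * g" "2 * X * (2 * Y) \<noteq> 0" for X Y Z W f g :: 'a
        using that by (auto simp: mult_ac)
      have "of_nat (Suc j) * (b + 1 / 2 + of_nat j) * F n = (1 / 2 + of_nat j) * (1 - b + of_nat j) * F m"
        and "of_nat (Suc j) * (b + 1 / 2 + of_nat j) \<noteq> 0"
        using cancel[OF rec[unfolded eqs] nz'[unfolded eqs]] by blast+
      then have "F n = (1 / 2 + of_nat j) * (1 - b + of_nat j) * F m / (of_nat (Suc j) * (b + 1 / 2 + of_nat j))"
        by (metis nonzero_mult_div_cancel_left)
      moreover have "n div 2 = Suc j" "even n" using 3 m by auto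
      ultimately show ?thesis
        unfolding IH by (simp add: pochhammer_Suc mult_ac)
    qed
  qed
qed

section \<open>Congruences in the p-adic numbers\<close>

lemma padic_ints_minus [simp, intro]: "x \<in> padic_ints \<Longrightarrow> y \<in> padic_ints \<Longrightarrow> x - y \<in> padic_ints"
  by (metis add_uminus_conv_diff padic_ints_closed(5,7))

lemma padic_ints_of_int [simp, intro]: "of_int z \<in> padic_ints"
  by (metis of_padic_int_of_int padic_ints_closed(4))

lemma padic_ints_numeral [simp, intro]: "numeral n \<in> padic_ints"
  by (metis of_nat_numeral padic_ints_closed(3))

lemma padic_ints_power [simp, intro]: "x \<in> padic_ints \<Longrightarrow> x ^ n \<in> padic_ints"
  by (induction n) auto

lemma padic_ints_prod [intro]: "(\<And>i. i \<in> I \<Longrightarrow> f i \<in> padic_ints) \<Longrightarrow> prod f I \<in> padic_ints"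
  by (induction I rule: infinite_finite_induct) auto

lemma padic_ints_pochhammer [intro]: "x \<in> padic_ints \<Longrightarrow> pochhammer x k \<in> padic_ints"
  unfolding pochhammer_prod by (rule padic_ints_prod) auto

lemma padic_cong_iff: "padic_cong k x y \<longleftrightarrow> (\<exists>z\<in>padic_ints. x = y + of_nat CARD('p) ^ k * z)"
  for x y :: "'p::prime_card padic"
  by (auto simp: padic_cong_def image_iff algebra_simps)

lemma padic_cong_refl [simp, intro]: "padic_cong k x x"
  by (auto simp: padic_cong_iff intro!: bexI[of _ 0])

lemma padic_cong_sym: "padic_cong k x y \<Longrightarrow> padic_cong k y x"
  unfolding padic_cong_iff_divide by (metis minus_diff_eq minus_divide_left padic_ints_closed(7))

lemma padic_cong_add: "padic_cong k x y \<Longrightarrow> padic_cong k x' y' \<Longrightarrow> padic_cong k (x + x') (y + y')"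
  unfolding padic_cong_iff_divide by (metis add_diff_add add_divide_distrib padic_ints_closed(5))

lemma padic_cong_trans [trans]: "padic_cong k x y \<Longrightarrow> padic_cong k y z \<Longrightarrow> padic_cong k x z"
  using padic_cong_add[of k x y y z] by (simp add: padic_cong_def)

lemma padic_cong_uminus: "padic_cong k x y \<Longrightarrow> padic_cong k (- x) (- y)"
  using padic_cong_sym[of k x y] by (simp add: padic_cong_def)

lemma padic_cong_diff: "padic_cong k x y \<Longrightarrow> padic_cong k x' y' \<Longrightarrow> padic_cong k (x - x') (y - y')"
  using padic_cong_add[OF _ padic_cong_uminus] by force

lemma padic_cong_mult_left: "padic_cong k x y \<Longrightarrow> c \<in> padic_ints \<Longrightarrow> padic_cong k (c * x) (c * y)"
  unfolding padic_cong_iff_divide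
  by (metis right_diff_distrib padic_ints_closed(6) times_divide_eq_right)

lemma padic_cong_ints_iff: "padic_cong k x y \<Longrightarrow> x \<in> padic_ints \<longleftrightarrow> y \<in> padic_ints"
proof -
  have "x \<in> padic_ints" if "padic_cong k x y" "y \<in> padic_ints" for x y
    using that by (force simp: padic_cong_iff)
  then show "padic_cong k x y \<Longrightarrow> x \<in> padic_ints \<longleftrightarrow> y \<in> padic_ints"
    using padic_cong_sym by blast
qed

text \<open>The relation is defined on the whole field, where products need not respect it. The
  splitting \<open>(x - y) * x' + y * (x' - y')\<close> of the difference shows which factors have
  to be integral.\<close>

lemma padic_cong_mult:
  assumes "padic_cong k x y" "padic_cong k x' y'" "x' \<in> padic_ints" "y \<in> padic_ints"
  shows "padic_cong k (x * x') (y * y')"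
proof (rule padic_cong_trans)
  show "padic_cong k (x * x') (y * x')"
    using padic_cong_mult_left[of k x y x'] assms by (simp add: mult.commute)
qed (use padic_cong_mult_left assms in auto)

lemma padic_cong_mono:
  assumes "padic_cong k x y" "l \<le> k"
  shows "padic_cong l x y"
proof -
  have "x = y + of_nat CARD('a) ^ l * (of_nat CARD('a) ^ (k - l) * z)"
    if "x = y + of_nat CARD('a) ^ k * z" for z
    using that assms(2) by (simp flip: power_add mult.assoc)
  then show ?thesis
    using assms(1) unfolding padic_cong_iff by (metis padic_ints_closed(3,6) padic_ints_power)
qed

lemma padic_cong_p_mult: "x \<in> padic_ints \<Longrightarrow> padic_cong 1 (of_nat CARD('p) * x) 0"
  for x :: "'p::prime_card padic"
  by (auto simp: padic_cong_iff)

lemma padic_cong_of_int_iff: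
  "padic_cong k (of_int x :: 'p::prime_card padic) (of_int y) \<longleftrightarrow> [x = y] (mod int CARD('p) ^ k)"
  using padic_cong_of_padic_int[of k "of_int x :: 'p padic_int" "of_int y"]
  by (simp add: padic_int_power_dvd_diff_iff Rep_padic_int_of_int cong_def)

section \<open>Units and residues\<close>

definition padic_unit :: "'p::prime_card padic \<Rightarrow> bool"
  where "padic_unit x \<longleftrightarrow> x \<in> padic_ints \<and> \<not> padic_cong 1 x 0"

lemma padic_unit_of_int_iff: "padic_unit (of_int z :: 'p::prime_card padic) \<longleftrightarrow> \<not> int CARD('p) dvd z"
  using padic_cong_of_int_iff[of 1 z 0, where 'p = 'p] by (simp add: padic_unit_def cong_0_iff)

lemma padic_unit_cong: "padic_cong k x y \<Longrightarrow> k \<ge> 1 \<Longrightarrow> padic_unit x \<longleftrightarrow> padic_unit y"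
  unfolding padic_unit_def
  using padic_cong_ints_iff[of k x y] padic_cong_mono[of k x y 1] padic_cong_sym padic_cong_trans by blast

lemma padic_unit_1 [simp]: "padic_unit (1 :: 'p::prime_card padic)"
  using padic_unit_of_int_iff[of 1, where 'p = 'p] CARD_prime_card_gt_1[where 'p = 'p] by simp

lemma padic_unit_ints [dest]: "padic_unit x \<Longrightarrow> x \<in> padic_ints"
  by (simp add: padic_unit_def)

lemma padic_unit_nonzero: "padic_unit x \<Longrightarrow> x \<noteq> 0"
  by (auto simp: padic_unit_def)

lemma padic_unit_inverse_ints:
  fixes x :: "'p::prime_card padic"
  assumes "padic_unit x"
  shows "inverse x \<in> padic_ints"
proof -
  obtain a where a: "x = of_padic_int a"
    using assms by (auto elim: padic_intsE)
  have "Rep_padic_int a 1 \<noteq> 0"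
    using assms padic_cong_of_padic_int[of 1 a 0] padic_int_power_dvd_iff[of 1 a]
    by (simp add: padic_unit_def a)
  then obtain b where "a * b = 1"
    using padic_int_unit[of a] by (metis dvdE)
  then have "x * of_padic_int b = 1"
    unfolding a by (metis of_padic_int_hom(2,6))
  then show ?thesis
    by (metis inverse_unique padic_ints_closed(4))
qed

lemma padic_unit_iff: "padic_unit x \<longleftrightarrow> x \<in> padic_ints \<and> x \<noteq> 0 \<and> inverse x \<in> padic_ints"
  for x :: "'p::prime_card padic"
proof
  assume x: "x \<in> padic_ints \<and> x \<noteq> 0 \<and> inverse x \<in> padic_ints"
  have "\<not> padic_cong 1 x 0"
  proof
    assume "padic_cong 1 x 0"
    then have "padic_cong 1 (inverse x * x) (inverse x * 0)"
      using x by (intro padic_cong_mult_left) auto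
    then show False
      using x padic_unit_1[where 'p = 'p] by (simp add: padic_unit_def)
  qed
  with x show "padic_unit x" by (simp add: padic_unit_def)
qed (use padic_unit_inverse_ints padic_unit_nonzero in auto)

lemma padic_unit_inverse: "padic_unit x \<Longrightarrow> padic_unit (inverse x)"
  by (simp only: padic_unit_iff) simp

lemma padic_unit_mult [intro]: "padic_unit x \<Longrightarrow> padic_unit y \<Longrightarrow> padic_unit (x * y)"
  unfolding padic_unit_iff by (simp add: padic_ints_closed(6))

lemma padic_unit_prod: "(\<And>i. i \<in> I \<Longrightarrow> padic_unit (f i)) \<Longrightarrow> padic_unit (prod f I)"
  by (induction I rule: infinite_finite_induct) auto

lemma padic_ints_divide: "x \<in> padic_ints \<Longrightarrow> padic_unit y \<Longrightarrow> x / y \<in> padic_ints"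
  by (simp add: divide_inverse padic_unit_inverse_ints)

lemma padic_residue:
  fixes x :: "'p::prime_card padic"
  assumes "x \<in> padic_ints"
  shows "padic_residue x < CARD('p)" and "padic_cong 1 x (of_nat (padic_residue x))"
proof -
  obtain a where a: "x = of_padic_int a" using assms by (rule padic_intsE)
  define r where "r = nat (Rep_padic_int a 1)"
  have r: "int r = Rep_padic_int a 1" by (simp add: r_def)
  have lt: "r < CARD('p)" using Rep_padic_int_less[of a 1] r by simp
  have iff: "padic_cong 1 x (of_nat s) \<longleftrightarrow> int r mod int CARD('p) = int s mod int CARD('p)" for s
    using padic_cong_of_padic_int[of 1 a "of_nat s"] padic_int_power_dvd_diff_iff[of 1 a "of_nat s"]
      Rep_padic_int_mod_self[of a 1] by (simp add: a Rep_padic_int_of_nat r)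
  have "padic_residue x = r"
    unfolding padic_residue_def using lt by (intro the_equality) (auto simp del: One_nat_def simp: iff)
  with lt iff show "padic_residue x < CARD('p)" "padic_cong 1 x (of_nat (padic_residue x))"
    by auto
qed


section \<open>Functions that are affine modulo the square of p\<close>

text \<open>The factor \<open>p\<close> in the slope pushes the quadratic term of a product into
  \<open>p ^ 2\<close>. This closes the class under products and under inverses of units, which
  polynomial functions and gamma quotients require.\<close>

definition affine_mod_sq :: "('p::prime_card padic \<Rightarrow> 'p padic) \<Rightarrow> bool"
  where "affine_mod_sq f \<longleftrightarrow> (\<exists>A\<in>padic_ints. \<exists>B\<in>padic_ints. \<forall>s\<in>padic_ints.
    padic_cong 2 (f s) (A + of_nat CARD('p) * (B * s)))"

lemma affine_mod_sqI:
  fixes f :: "'p::prime_card padic \<Rightarrow> 'p padic"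
  assumes "A \<in> padic_ints" "B \<in> padic_ints"
    and "\<And>s. s \<in> padic_ints \<Longrightarrow> padic_cong 2 (f s) (A + of_nat CARD('p) * (B * s))"
  shows "affine_mod_sq f"
  using assms by (auto simp: affine_mod_sq_def)

lemma affine_mod_sqE:
  fixes f :: "'p::prime_card padic \<Rightarrow> 'p padic"
  assumes "affine_mod_sq f"
  obtains A B where "A \<in> padic_ints" "B \<in> padic_ints"
    "\<And>s. s \<in> padic_ints \<Longrightarrow> padic_cong 2 (f s) (A + of_nat CARD('p) * (B * s))"
  using assms by (auto simp: affine_mod_sq_def)

lemma affine_mod_sq_ints:
  assumes "affine_mod_sq f" "s \<in> padic_ints"
  shows "f s \<in> padic_ints"
  using assms unfolding affine_mod_sq_def
  by (metis padic_cong_ints_iff padic_ints_closed(3,5,6))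

lemma affine_mod_sq_cong:
  assumes "affine_mod_sq f" "\<And>s. s \<in> padic_ints \<Longrightarrow> padic_cong 2 (g s) (f s)"
  shows "affine_mod_sq g"
  using assms unfolding affine_mod_sq_def by (meson padic_cong_trans)

lemma affine_mod_sq_const: "c \<in> padic_ints \<Longrightarrow> affine_mod_sq (\<lambda>s. c)"
  by (rule affine_mod_sqI[of c 0]) auto

lemma affine_mod_sq_affine:
  "c \<in> padic_ints \<Longrightarrow> d \<in> padic_ints \<Longrightarrow> affine_mod_sq (\<lambda>s. c + of_nat CARD('p) * (d * s))"
  for c :: "'p::prime_card padic"
  by (rule affine_mod_sqI[of c d]) auto

lemma affine_mod_sq_add:
  fixes f g :: "'p::prime_card padic \<Rightarrow> 'p padic"
  assumes "affine_mod_sq f" "affine_mod_sq g"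
  shows "affine_mod_sq (\<lambda>s. f s + g s)"
proof -
  obtain A B where AB: "A \<in> padic_ints" "B \<in> padic_ints"
    and f: "\<And>s. s \<in> padic_ints \<Longrightarrow> padic_cong 2 (f s) (A + of_nat CARD('p) * (B * s))"
    using affine_mod_sqE[OF assms(1)] by metis
  obtain A' B' where AB': "A' \<in> padic_ints" "B' \<in> padic_ints"
    and g: "\<And>s. s \<in> padic_ints \<Longrightarrow> padic_cong 2 (g s) (A' + of_nat CARD('p) * (B' * s))"
    using affine_mod_sqE[OF assms(2)] by metis
  note fg = f g and ints = AB AB'
  show ?thesis
  proof (rule affine_mod_sqI[of "A + A'" "B + B'"])
    fix s :: "'p padic" assume "s \<in> padic_ints"
    then show "padic_cong 2 (f s + g s) (A + A' + of_nat CARD('p) * ((B + B') * s))"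
      using padic_cong_add[OF fg(1) fg(2), of s s] by (simp add: algebra_simps)
  qed (use ints in auto)
qed

lemma affine_mod_sq_mult:
  fixes f g :: "'p::prime_card padic \<Rightarrow> 'p padic"
  assumes "affine_mod_sq f" "affine_mod_sq g"
  shows "affine_mod_sq (\<lambda>s. f s * g s)"
proof -
  let ?p = "of_nat CARD('p) :: 'p padic"
  obtain A B where AB: "A \<in> padic_ints" "B \<in> padic_ints"
    and f: "\<And>s. s \<in> padic_ints \<Longrightarrow> padic_cong 2 (f s) (A + ?p * (B * s))"
    using affine_mod_sqE[OF assms(1)] by metis
  obtain A' B' where AB': "A' \<in> padic_ints" "B' \<in> padic_ints"
    and g: "\<And>s. s \<in> padic_ints \<Longrightarrow> padic_cong 2 (g s) (A' + ?p * (B' * s))"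
    using affine_mod_sqE[OF assms(2)] by metis
  note fg = f g and ints = AB AB'
  show ?thesis
  proof (rule affine_mod_sqI[of "A * A'" "A * B' + B * A'"])
    fix s :: "'p padic" assume s: "s \<in> padic_ints"
    have "padic_cong 2 (f s * g s) ((A + ?p * (B * s)) * (A' + ?p * (B' * s)))"
      using s ints affine_mod_sq_ints[OF assms(2)] by (intro padic_cong_mult fg) auto
    also have "padic_cong 2 ((A + ?p * (B * s)) * (A' + ?p * (B' * s))) (A * A' + ?p * ((A * B' + B * A') * s))"
      unfolding padic_cong_iff using s ints
      by (intro bexI[of _ "B * B' * s\<^sup>2"]) (auto simp: algebra_simps power2_eq_square)
    finally show "padic_cong 2 (f s * g s) (A * A' + ?p * ((A * B' + B * A') * s))" .
  qed (use ints in auto)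
qed

lemma affine_mod_sq_uminus: "affine_mod_sq f \<Longrightarrow> affine_mod_sq (\<lambda>s. - f s)"
  using affine_mod_sq_mult[OF affine_mod_sq_const[of "- 1"], of f] by simp

lemma affine_mod_sq_sum: "(\<And>i. i \<in> I \<Longrightarrow> affine_mod_sq (f i)) \<Longrightarrow> affine_mod_sq (\<lambda>s. \<Sum>i\<in>I. f i s)"
  by (induction I rule: infinite_finite_induct) (auto intro!: affine_mod_sq_const affine_mod_sq_add)

lemma affine_mod_sq_prod: "(\<And>i. i \<in> I \<Longrightarrow> affine_mod_sq (f i)) \<Longrightarrow> affine_mod_sq (\<lambda>s. \<Prod>i\<in>I. f i s)"
  by (induction I rule: infinite_finite_induct) (auto intro!: affine_mod_sq_const affine_mod_sq_mult)

text \<open>The geometric series stopped after first order: with \<open>A' = inverse A\<close>, the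
  product of \<open>A + p * B * s\<close> and \<open>A' - p * B * A'\<^sup>2 * s\<close> is
  \<open>1 - p\<^sup>2 * B\<^sup>2 * A'\<^sup>2 * s\<^sup>2\<close>.\<close>

lemma affine_mod_sq_inverse:
  fixes f :: "'p::prime_card padic \<Rightarrow> 'p padic"
  assumes "affine_mod_sq f" and unit: "\<And>s. s \<in> padic_ints \<Longrightarrow> padic_unit (f s)"
  shows "affine_mod_sq (\<lambda>s. inverse (f s))"
proof -
  let ?p = "of_nat CARD('p) :: 'p padic"
  obtain A B where ints: "A \<in> padic_ints" "B \<in> padic_ints"
    and f: "\<And>s. s \<in> padic_ints \<Longrightarrow> padic_cong 2 (f s) (A + ?p * (B * s))"
    using affine_mod_sqE[OF assms(1)] by metis
  have A: "padic_unit A"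
    using unit[of 0] padic_unit_cong[OF f[of 0]] by simp
  define A' where "A' = inverse A"
  have A': "A * A' = 1" "A' \<in> padic_ints"
    using A by (simp_all add: A'_def padic_unit_inverse_ints padic_unit_nonzero)
  show ?thesis
  proof (rule affine_mod_sqI[of A' "- (B * A'\<^sup>2)"])
    fix s :: "'p padic" assume s: "s \<in> padic_ints"
    define h where "h = A' + ?p * (- (B * A'\<^sup>2) * s)"
    have h: "h \<in> padic_ints" using ints A' s by (auto simp: h_def)
    have "padic_cong 2 (h * f s) (h * (A + ?p * (B * s)))"
      using f s h by (intro padic_cong_mult_left) auto
    also have "padic_cong 2 (h * (A + ?p * (B * s))) 1"
    proof -
      have "h * (A + ?p * (B * s)) = A * A' + ?p * B * s * A' * (1 - A * A') + ?p ^ 2 * (- (B\<^sup>2 * A'\<^sup>2 * s\<^sup>2))"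
        unfolding h_def by (simp add: algebra_simps power2_eq_square)
      then show ?thesis
        unfolding padic_cong_iff using ints A' s by (intro bexI[of _ "- (B\<^sup>2 * A'\<^sup>2 * s\<^sup>2)"]) auto
    qed
    finally have "padic_cong 2 (inverse (f s) * (h * f s)) (inverse (f s) * 1)"
      using unit[OF s] by (intro padic_cong_mult_left padic_unit_inverse_ints)
    then have "padic_cong 2 h (inverse (f s))"
      using padic_unit_nonzero[OF unit[OF s]] by (simp add: mult.left_commute)
    then show "padic_cong 2 (inverse (f s)) (A' + ?p * (- (B * A'\<^sup>2) * s))"
      by (auto simp: h_def dest: padic_cong_sym)
  qed (use ints A' in auto)
qed

text \<open>Let \<open>A + p * B * s\<close> represent the difference. Its value at 0 gives
  \<open>A\<close> congruent to 0, its value at 1 then gives the same for \<open>p * B\<close>, and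
  these two settle every \<open>s\<close>.\<close>

lemma affine_mod_sq_determined:
  fixes f g :: "'p::prime_card padic \<Rightarrow> 'p padic"
  assumes "affine_mod_sq f" "affine_mod_sq g" and 0: "padic_cong 2 (f 0) (g 0)" and 1: "padic_cong 2 (f 1) (g 1)"
    and s: "s \<in> padic_ints"
  shows "padic_cong 2 (f s) (g s)"
proof -
  have "affine_mod_sq (\<lambda>s. f s + - g s)"
    using assms by (intro affine_mod_sq_add affine_mod_sq_uminus)
  then obtain A B where ints: "A \<in> padic_ints" "B \<in> padic_ints"
    and h: "\<And>s. s \<in> padic_ints \<Longrightarrow> padic_cong 2 (f s - g s) (A + of_nat CARD('p) * (B * s))"
    unfolding affine_mod_sq_def by auto
  have diff0: "padic_cong 2 x y \<longleftrightarrow> padic_cong 2 (x - y) 0" for x y :: "'p padic"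
    by (simp add: padic_cong_def)
  have A: "padic_cong 2 A 0"
    using padic_cong_trans[OF padic_cong_sym[OF h[of 0]]] 0 diff0 by simp
  have "padic_cong 2 (A + of_nat CARD('p) * B) 0"
    using padic_cong_trans[OF padic_cong_sym[OF h[of 1]]] 1 diff0 by simp
  from padic_cong_diff[OF this A] have B: "padic_cong 2 (of_nat CARD('p) * B) 0"
    by simp
  have "padic_cong 2 (A + s * (of_nat CARD('p) * B)) (0 + s * 0)"
    using A B s by (intro padic_cong_add padic_cong_mult_left)
  then have "padic_cong 2 (f s - g s) 0"
    using padic_cong_trans[OF h[OF s]] by (simp add: mult_ac)
  then show ?thesis using diff0 by blast
qed

section \<open>Values of the p-adic gamma function\<close>

lemma padic_cong_prod:
  assumes "\<And>i. i \<in> I \<Longrightarrow> padic_cong k (f i) (g i)" "\<And>i. i \<in> I \<Longrightarrow> f i \<in> padic_ints"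
  shows "padic_cong k (prod f I) (prod g I)"
  using assms
proof (induction I rule: infinite_finite_induct)
  case (insert i I)
  then have "g i \<in> padic_ints"
    using padic_cong_ints_iff by blast
  with insert show ?case
    by (auto intro!: padic_cong_mult)
qed auto

lemma padic_unit_of_padic_int_iff:
  "padic_unit (of_padic_int a) \<longleftrightarrow> \<not> of_nat CARD('p) dvd a" for a :: "'p::prime_card padic_int"
  using padic_cong_of_padic_int[of 1 a 0] by (simp add: padic_unit_def)

lemma padic_unit_int_add_p_mult:
  fixes x :: "'p::prime_card padic"
  assumes "x = of_int z + of_nat CARD('p) * t" "t \<in> padic_ints" "\<not> int CARD('p) dvd z"
  shows "padic_unit x"
proof -
  have "padic_cong 1 x (of_int z)"
    using padic_cong_add[OF padic_cong_refl padic_cong_p_mult[OF assms(2)], of "of_int z"] assms(1) by simp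
  with assms(3) show ?thesis
    by (simp add: padic_unit_cong padic_unit_of_int_iff)
qed

context
  assumes odd_CARD: "odd CARD('p::prime_card)"
begin

lemma padic_unit_half: "padic_unit (1 / 2 :: 'p padic)"
proof -
  have "CARD('p) \<noteq> 2"
    using odd_CARD by auto
  then have "\<not> int CARD('p) dvd 2"
    using zdvd_imp_le[of "int CARD('p)" 2] CARD_prime_card_gt_1[where 'p = 'p] by auto
  then have "padic_unit (2 :: 'p padic)"
    using padic_unit_of_int_iff[of 2, where 'p = 'p] by simp
  from padic_unit_inverse[OF this] show ?thesis
    by simp
qed

text \<open>For gamma arguments near half-integers: 2 is a unit, so the test can be made after
  doubling, on an integer.\<close>

lemma padic_unit_half_int_add_p_mult:
  fixes x :: "'p padic"
  assumes "2 * x = of_int z + of_nat CARD('p) * t" "t \<in> padic_ints" "\<not> int CARD('p) dvd z"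
  shows "padic_unit x"
proof -
  have "padic_unit (1 / 2 * (2 * x))"
    using padic_unit_half padic_unit_int_add_p_mult[OF assms] by (rule padic_unit_mult)
  then show ?thesis by simp
qed

lemma padic_Gamma_ints: "x \<in> padic_ints \<Longrightarrow> padic_Gamma x \<in> padic_ints" for x :: "'p padic"
  by (elim padic_intsE) (simp add: padic_Gamma_of_padic_int odd_CARD)

lemma padic_Gamma_of_nat: "padic_Gamma (of_nat n :: 'p padic) = of_int (morita_nat CARD('p) n)"
  using padic_Gamma_of_padic_int[OF odd_CARD, of "of_nat n"] by (simp add: gamma_padic_int_of_nat odd_CARD)

lemma padic_Gamma_cong:
  fixes x y :: "'p padic"
  assumes "padic_cong k x y" "x \<in> padic_ints" "y \<in> padic_ints"
  shows "padic_cong k (padic_Gamma x) (padic_Gamma y)"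
  using assms by (elim padic_intsE)
    (simp add: padic_Gamma_of_padic_int odd_CARD padic_cong_of_padic_int gamma_padic_int_cong)

lemma padic_unit_Gamma:
  fixes x :: "'p padic"
  assumes "x \<in> padic_ints"
  shows "padic_unit (padic_Gamma x)"
proof -
  obtain n where "padic_cong 1 (of_nat n) x"
    using padic_ints_dense_nat[OF assms] .
  then have "padic_cong 1 (padic_Gamma (of_nat n)) (padic_Gamma x)"
    using assms by (intro padic_Gamma_cong) auto
  moreover have "padic_unit (padic_Gamma (of_nat n :: 'p padic))"
    using not_dvd_morita_nat[OF prime_CARD_prime_card[where 'p = 'p]]
    by (simp add: padic_Gamma_of_nat padic_unit_of_int_iff)
  ultimately show ?thesis
    using padic_unit_cong by blast
qed

lemma padic_Gamma_add_1:
  fixes x :: "'p padic"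
  assumes "x \<in> padic_ints"
  shows "padic_Gamma (x + 1) = (if padic_unit x then - x else - 1) * padic_Gamma x"
proof -
  obtain a where a: "x = of_padic_int a" using assms by (rule padic_intsE)
  have "padic_Gamma (x + 1) = of_padic_int (gamma_padic_int (a + 1))"
    using padic_Gamma_of_padic_int[OF odd_CARD, of "a + 1"] by (simp add: a)
  then show ?thesis
    by (simp add: a padic_Gamma_of_padic_int odd_CARD gamma_padic_int_add_1 padic_unit_of_padic_int_iff)
qed

lemma padic_Gamma_add_of_nat:
  fixes x :: "'p padic"
  assumes "x \<in> padic_ints" "\<And>j. j < m \<Longrightarrow> padic_unit (x + of_nat j)"
  shows "padic_Gamma (x + of_nat m) = (- 1) ^ m * pochhammer x m * padic_Gamma x"
  using assms(2)
proof (induction m)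
  case (Suc m)
  have "padic_Gamma (x + of_nat m + 1) = - (x + of_nat m) * padic_Gamma (x + of_nat m)"
    using Suc.prems[of m] assms(1) by (subst padic_Gamma_add_1) auto
  with Suc show ?case by (simp add: pochhammer_Suc algebra_simps)
qed simp

text \<open>Neither side changes modulo \<open>p ^ 2\<close> when \<open>y\<close> is replaced by a
  natural number congruent to it modulo \<open>p ^ 2\<close>, and there
  \<open>morita_nat_mod_square\<close> applies.\<close>

lemma padic_Gamma_mod_sq:
  assumes r: "r < CARD('p)"
  obtains w :: int where "\<And>y :: 'p padic. y \<in> padic_ints \<Longrightarrow>
    padic_cong 2 (padic_Gamma (of_nat r + of_nat CARD('p) * y))
      ((1 + of_nat CARD('p) * (of_int w * y)) * ((- 1) ^ r * (\<Prod>j\<in>{1..<r}. of_nat j + of_nat CARD('p) * y)))"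
proof -
  let ?p = "of_nat CARD('p) :: 'p padic"
  obtain w where w: "\<And>n. [morita_nat CARD('p) (r + CARD('p) * n)
    = (1 + int CARD('p) * w * int n) * ((- 1) ^ r * (\<Prod>j\<in>{1..<r}. int j + int CARD('p) * int n))] (mod (int CARD('p))\<^sup>2)"
    using morita_nat_mod_square[OF prime_CARD_prime_card odd_CARD] r by metis
  show ?thesis
  proof (rule that[of w])
    fix y :: "'p padic" assume y: "y \<in> padic_ints"
    define R where "R y = (1 + ?p * (of_int w * y)) * ((- 1) ^ r * (\<Prod>j\<in>{1..<r}. of_nat j + ?p * y))" for y
    obtain n where n: "padic_cong 2 (of_nat n) y"
      using padic_ints_dense_nat[OF y] .
    have "padic_cong 2 (padic_Gamma (of_nat r + ?p * y)) (padic_Gamma (of_nat r + ?p * of_nat n))"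
      using n y by (intro padic_Gamma_cong padic_cong_add padic_cong_mult_left) (auto intro: padic_cong_sym)
    also have "of_nat r + ?p * of_nat n = of_nat (r + CARD('p) * n)"
      by simp
    also have "padic_Gamma (of_nat (r + CARD('p) * n) :: 'p padic) = of_int (morita_nat CARD('p) (r + CARD('p) * n))"
      by (rule padic_Gamma_of_nat)
    also have "padic_cong 2 \<dots> (of_int ((1 + int CARD('p) * w * int n) * ((- 1) ^ r * (\<Prod>j\<in>{1..<r}. int j + int CARD('p) * int n))) :: 'p padic)"
      by (subst padic_cong_of_int_iff) (rule w)
    also have "of_int ((1 + int CARD('p) * w * int n) * ((- 1) ^ r * (\<Prod>j\<in>{1..<r}. int j + int CARD('p) * int n))) = R (of_nat n)"
      by (simp add: R_def mult.assoc)
    also have "padic_cong 2 (R (of_nat n)) (R y)"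
      unfolding R_def using y n
      by (intro padic_cong_mult padic_cong_add padic_cong_refl padic_cong_prod padic_cong_mult_left)
        (auto intro!: padic_ints_prod padic_ints_closed padic_ints_power)
    finally show "padic_cong 2 (padic_Gamma (of_nat r + ?p * y)) ((1 + ?p * (of_int w * y)) * ((- 1) ^ r * (\<Prod>j\<in>{1..<r}. of_nat j + ?p * y)))"
      by (simp add: R_def)
  qed
qed

text \<open>Writing \<open>c = r + p * y\<close> turns the argument into
  \<open>r + p * (y + d * s)\<close>, where \<open>r\<close> does not depend on \<open>s\<close>.
  The explicit product for this \<open>r\<close> then consists of affine factors.\<close>

lemma affine_mod_sq_Gamma:
  fixes c d :: "'p padic"
  assumes "c \<in> padic_ints" "d \<in> padic_ints"
  shows "affine_mod_sq (\<lambda>s. padic_Gamma (c + of_nat CARD('p) * (d * s)))"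
proof -
  let ?p = "of_nat CARD('p) :: 'p padic"
  define r where "r = padic_residue c"
  obtain y where y: "y \<in> padic_ints" "c = of_nat r + ?p * y"
    using padic_residue(2)[OF assms(1)] by (auto simp: padic_cong_iff r_def)
  obtain w where w: "\<And>y. y \<in> padic_ints \<Longrightarrow> padic_cong 2 (padic_Gamma (of_nat r + ?p * y))
      ((1 + ?p * (of_int w * y)) * ((- 1) ^ r * (\<Prod>j\<in>{1..<r}. of_nat j + ?p * y)))"
    using padic_Gamma_mod_sq padic_residue(1)[OF assms(1)] unfolding r_def by metis
  have lin: "affine_mod_sq (\<lambda>s. u + ?p * (v * (y + d * s)))" if "u \<in> padic_ints" "v \<in> padic_ints" for u v
    using affine_mod_sq_affine[of "u + ?p * (v * y)" "v * d"] that y assms by (simp add: algebra_simps)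
  have "affine_mod_sq (\<lambda>s. (1 + ?p * (of_int w * (y + d * s)))
      * ((- 1) ^ r * (\<Prod>j\<in>{1..<r}. of_nat j + ?p * (1 * (y + d * s)))))"
    by (intro affine_mod_sq_mult affine_mod_sq_prod affine_mod_sq_const lin) auto
  then show ?thesis
  proof (rule affine_mod_sq_cong)
    fix s :: "'p padic" assume "s \<in> padic_ints"
    then show "padic_cong 2 (padic_Gamma (c + ?p * (d * s))) ((1 + ?p * (of_int w * (y + d * s)))
      * ((- 1) ^ r * (\<Prod>j\<in>{1..<r}. of_nat j + ?p * (1 * (y + d * s)))))"
      using w[of "y + d * s"] y assms by (simp add: algebra_simps)
  qed
qed

text \<open>
  The only factor of the denominator divisible by \<open>p\<close>, namely \<open>2 * \<beta> + 2 * b\<close>, is twice a factor of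
  the numerator.
\<close>

lemma pochhammer_ratio_ints:
  fixes \<beta> t :: "'p padic"
  assumes b: "2 * b < CARD('p)" and t: "t \<in> padic_ints" and \<beta>: "\<beta> = - of_nat b + of_nat CARD('p) * t"
    and nz: "pochhammer (2 * \<beta>) (CARD('p) - 1) \<noteq> 0" and k: "k \<le> CARD('p) - 1"
  shows "pochhammer \<beta> k / pochhammer (2 * \<beta>) k \<in> padic_ints"
proof -
  have ints: "\<beta> \<in> padic_ints" using t by (simp add: \<beta>)
  have unit: "padic_unit (2 * \<beta> + of_nat j)" if "j < CARD('p)" "j \<noteq> 2 * b" for j
  proof (rule padic_unit_int_add_p_mult)
    show "2 * \<beta> + of_nat j = of_int (int j - 2 * int b) + of_nat CARD('p) * (2 * t)"
      by (simp add: \<beta> algebra_simps)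
    have "\<bar>int j - 2 * int b\<bar> < int CARD('p)" using that b by linarith
    then show "\<not> int CARD('p) dvd int j - 2 * int b"
      using that dvd_imp_le_int[of "int j - 2 * int b" "int CARD('p)"] by auto
  qed (use t in auto)
  show ?thesis
  proof (cases "k \<le> 2 * b")
    case True
    then have "padic_unit (pochhammer (2 * \<beta>) k)"
      unfolding pochhammer_prod using b by (intro padic_unit_prod unit) auto
    with ints show ?thesis by (intro padic_ints_divide padic_ints_pochhammer)
  next
    case False
    define X where "X = (\<Prod>i\<in>{0..<k} - {b}. \<beta> + of_nat i)"
    define U where "U = (\<Prod>i\<in>{0..<k} - {2 * b}. 2 * \<beta> + of_nat i)"
    have "pochhammer \<beta> k = (\<beta> + of_nat b) * X"
      unfolding pochhammer_prod X_def using False by (intro prod.remove) auto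
    moreover have eq: "pochhammer (2 * \<beta>) k = (2 * \<beta> + of_nat (2 * b)) * U"
      unfolding pochhammer_prod U_def using False by (intro prod.remove) auto
    moreover have double: "2 * \<beta> + of_nat (2 * b) = 2 * (\<beta> + of_nat b)"
      by simp
    \<comment> \<open>The common factor may be cancelled only if it is nonzero, and this is what the
      nonvanishing of the full denominator provides.\<close>
    moreover have "\<beta> + of_nat b \<noteq> 0"
    proof
      assume "\<beta> + of_nat b = 0"
      then have "pochhammer (2 * \<beta>) k = 0"
        unfolding eq double by simp
      with nz k show False
        using pochhammer_neq_0_mono by blast
    qed
    ultimately have ratio: "pochhammer \<beta> k / pochhammer (2 * \<beta>) k = 1 / 2 * (X / U)"
      by (simp only: mult.assoc mult_divide_mult_cancel_left) simp
    have "X \<in> padic_ints"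
      unfolding X_def using ints by (intro padic_ints_prod) auto
    moreover have "padic_unit U"
      unfolding U_def using k by (intro padic_unit_prod unit) auto
    ultimately have "X / U \<in> padic_ints"
      by (rule padic_ints_divide)
    with padic_unit_half show ?thesis
      unfolding ratio by blast
  qed
qed

text \<open>The case \<alpha> = \<open>- 2 * m\<close> of the gamma quotient. Each of the four
  denominator arguments is \<open>m\<close> unit steps away from a numerator argument or from 1. The
  bounds on \<open>b\<close> and \<open>m\<close> ensure that every step is taken at a unit: the
  integers tested are nonzero, for half-integers because they are odd, and smaller than
  \<open>p\<close> in absolute value.\<close>

lemma padic_Gamma_quotient_even:
  fixes \<beta> t :: "'p padic"
  assumes b: "2 * b < CARD('p)" and t: "t \<in> padic_ints" and \<beta>: "\<beta> = - of_nat b + of_nat CARD('p) * t"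
    and m: "2 * m < CARD('p)"
  shows "- (padic_Gamma (1 / 2) * padic_Gamma (1 / 2 + \<beta>) * padic_Gamma \<beta>) /
      (padic_Gamma (1 / 2 - of_nat m) * padic_Gamma (1 + of_nat m) *
       padic_Gamma (1 / 2 + \<beta> + of_nat m) * padic_Gamma (\<beta> - of_nat m))
    = pochhammer (1 / 2) m * pochhammer (1 - \<beta>) m / (fact m * pochhammer (\<beta> + 1 / 2) m)"
proof -
  let ?p = "of_nat CARD('p) :: 'p padic"
  have ints: "\<beta> \<in> padic_ints" "1 / 2 \<in> (padic_ints :: 'p padic set)"
    using t padic_unit_half by (auto simp: \<beta>)
  have small: "\<not> int CARD('p) dvd z" if "z \<noteq> 0" "\<bar>z\<bar> < int CARD('p)" for z
    using that dvd_imp_le_int[of z "int CARD('p)"] by auto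
  have "padic_Gamma (1 / 2 - of_nat m + of_nat m :: 'p padic)
      = (- 1) ^ m * pochhammer (1 / 2 - of_nat m) m * padic_Gamma (1 / 2 - of_nat m)"
  proof (rule padic_Gamma_add_of_nat)
    fix j assume j: "j < m"
    show "padic_unit (1 / 2 - of_nat m + of_nat j :: 'p padic)"
    proof (rule padic_unit_half_int_add_p_mult[where t = 0])
      show "2 * (1 / 2 - of_nat m + of_nat j :: 'p padic) = of_int (1 - 2 * int m + 2 * int j) + ?p * 0"
        by (simp add: algebra_simps)
      show "\<not> int CARD('p) dvd 1 - 2 * int m + 2 * int j"
      proof (rule small)
        show "1 - 2 * int m + 2 * int j \<noteq> 0" by presburger
      qed (use j m in linarith)
    qed auto
  qed (use ints in auto)
  moreover have "pochhammer (1 / 2 - of_nat m :: 'p padic) m = (- 1) ^ m * pochhammer (1 / 2) m"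
    using pochhammer_minus[of "of_nat m - 1 / 2 :: 'p padic" m] by simp
  ultimately have 1: "padic_Gamma (1 / 2 :: 'p padic) = pochhammer (1 / 2) m * padic_Gamma (1 / 2 - of_nat m)"
    by simp
  have "padic_Gamma (\<beta> - of_nat m + of_nat m) = (- 1) ^ m * pochhammer (\<beta> - of_nat m) m * padic_Gamma (\<beta> - of_nat m)"
  proof (rule padic_Gamma_add_of_nat)
    fix j assume j: "j < m"
    show "padic_unit (\<beta> - of_nat m + of_nat j)"
    proof (rule padic_unit_int_add_p_mult[where t = t])
      show "\<beta> - of_nat m + of_nat j = of_int (int j - int m - int b) + ?p * t"
        by (simp add: \<beta>)
      show "\<not> int CARD('p) dvd int j - int m - int b"
        using j m b by (intro small) linarith+
    qed (use t in auto)
  qed (use ints in auto)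
  moreover have "pochhammer (\<beta> - of_nat m) m = (- 1) ^ m * pochhammer (1 - \<beta>) m"
    using pochhammer_minus[of "of_nat m - \<beta>" m] by simp
  ultimately have 2: "padic_Gamma \<beta> = pochhammer (1 - \<beta>) m * padic_Gamma (\<beta> - of_nat m)"
    by simp
  have "padic_Gamma (1 + of_nat m :: 'p padic) = (- 1) ^ m * pochhammer 1 m * padic_Gamma 1"
  proof (rule padic_Gamma_add_of_nat)
    fix j assume j: "j < m"
    show "padic_unit (1 + of_nat j :: 'p padic)"
    proof (rule padic_unit_int_add_p_mult[where t = 0])
      show "1 + of_nat j = of_int (1 + int j) + ?p * 0" by simp
      show "\<not> int CARD('p) dvd 1 + int j"
        using j m by (intro small) linarith+
    qed auto
  qed auto
  moreover have "padic_Gamma (1 :: 'p padic) = - 1"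
    using padic_Gamma_of_nat[of 1] by (simp add: morita_nat_Suc unit_part_def)
  ultimately have 3: "padic_Gamma (1 + of_nat m :: 'p padic) = - ((- 1) ^ m * fact m)"
    by (simp add: pochhammer_fact)
  have u4: "padic_unit (1 / 2 + \<beta> + of_nat j)" if j: "j < m" for j
  proof (rule padic_unit_half_int_add_p_mult[where t = "2 * t"])
    show "2 * (1 / 2 + \<beta> + of_nat j) = of_int (1 + 2 * int j - 2 * int b) + ?p * (2 * t)"
      by (simp add: \<beta> algebra_simps)
    show "\<not> int CARD('p) dvd 1 + 2 * int j - 2 * int b"
    proof (rule small)
      show "1 + 2 * int j - 2 * int b \<noteq> 0" by presburger
    qed (use j m b in linarith)
  qed (use t in auto)
  then have 4: "padic_Gamma (1 / 2 + \<beta> + of_nat m) = (- 1) ^ m * pochhammer (1 / 2 + \<beta>) m * padic_Gamma (1 / 2 + \<beta>)"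
    using ints by (intro padic_Gamma_add_of_nat) auto
  have "padic_unit (pochhammer (1 / 2 + \<beta>) m)"
    unfolding pochhammer_prod by (intro padic_unit_prod u4) auto
  then have "pochhammer (1 / 2 + \<beta>) m \<noteq> 0"
    by (rule padic_unit_nonzero)
  moreover have "padic_Gamma x \<noteq> 0" if "x \<in> padic_ints" for x :: "'p padic"
    using padic_unit_Gamma[OF that] by (rule padic_unit_nonzero)
  then have "padic_Gamma (1 / 2 - of_nat m :: 'p padic) \<noteq> 0" "padic_Gamma (\<beta> - of_nat m) \<noteq> 0"
    "padic_Gamma (1 / 2 + \<beta>) \<noteq> 0"
    using ints by auto
  \<comment> \<open>The signs \<open>(- 1) ^ m\<close> from \<open>3\<close> and \<open>4\<close>
    cancel each other, and the value \<open>- 1\<close> of the gamma function at 1 absorbs the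
    leading minus sign.\<close>
  ultimately show ?thesis
    unfolding 1 2 3 4 by (simp add: add.commute[of \<beta>])
qed

end

section \<open>Both sides as functions of \<alpha>, and their comparison\<close>

theorem theorem2p9:
  fixes p :: nat and \<alpha> \<beta> :: "'p::prime_card padic"
  assumes p: "p = CARD('p)" and "odd p"
    and "\<alpha> \<in> padic_ints" and "\<beta> \<in> padic_ints"
    and "real (padic_residue (- \<beta>)) < real p / 2"
    and "\<not> padic_cong 2 (pochhammer (2 * \<beta>) (p - 1)) 0"
  shows "(even (padic_residue (- \<alpha>)) \<longrightarrow>
           padic_cong 2
             (trunc_hypergeo [\<alpha>, 1 - \<alpha>, \<beta>] [1, 2 * \<beta>] 1 (p - 1))
             (- (padic_Gamma (1 / 2) * padic_Gamma (1 / 2 + \<beta>) * padic_Gamma \<beta>) /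
               (padic_Gamma (1 / 2 + 1 / 2 * \<alpha>) * padic_Gamma (1 - 1 / 2 * \<alpha>) *
                padic_Gamma (1 / 2 + \<beta> - 1 / 2 * \<alpha>) * padic_Gamma (\<beta> + 1 / 2 * \<alpha>)))) \<and>
         (odd (padic_residue (- \<alpha>)) \<longrightarrow>
           padic_cong 2 (trunc_hypergeo [\<alpha>, 1 - \<alpha>, \<beta>] [1, 2 * \<beta>] 1 (p - 1)) 0)"
proof -
  let ?p = "of_nat CARD('p) :: 'p padic"
  have odd: "odd CARD('p)" using assms by simp
  have half: "1 / 2 \<in> (padic_ints :: 'p padic set)"
    using padic_unit_half[OF odd] by blast
  have shift: "\<exists>t\<in>padic_ints. x = - of_nat (padic_residue (- x)) + ?p * t" if x: "x \<in> padic_ints" for x :: "'p padic"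
  proof -
    obtain t where t: "t \<in> padic_ints" "- x = of_nat (padic_residue (- x)) + ?p * t"
      using padic_residue(2)[OF padic_ints_closed(7)[OF x]] by (auto simp: padic_cong_iff)
    from t(2) have "x = - (of_nat (padic_residue (- x)) + ?p * t)"
      by (metis minus_minus)
    with t(1) show ?thesis
      by (intro bexI[of _ "- t"]) auto
  qed
  define a where "a = padic_residue (- \<alpha>)"
  define b where "b = padic_residue (- \<beta>)"
  obtain s where s: "s \<in> padic_ints" "\<alpha> = - of_nat a + ?p * s"
    using shift[of \<alpha>] assms a_def by auto
  obtain t where t: "t \<in> padic_ints" "\<beta> = - of_nat b + ?p * t"
    using shift[of \<beta>] assms b_def by auto
  have a: "a < CARD('p)"
    using padic_residue(1)[of "- \<alpha>"] assms by (simp add: a_def)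
  have b: "2 * b < CARD('p)"
    using assms by (simp add: b_def)
  have nz: "pochhammer (2 * \<beta>) (CARD('p) - 1) \<noteq> 0"
    using assms by auto
  \<comment> \<open>The factor of the summand that is free of \<alpha>. Its integrality makes
    \<open>S\<close> a polynomial with integral coefficients.\<close>
  define W where "W k = pochhammer \<beta> k / (fact k * fact k * pochhammer (2 * \<beta>) k)" for k
  define S where "S x = (\<Sum>k\<le>CARD('p) - 1. pochhammer x k * pochhammer (1 - x) k * W k)" for x
  define G where "G x = - (padic_Gamma (1 / 2) * padic_Gamma (1 / 2 + \<beta>) * padic_Gamma \<beta>) /
               (padic_Gamma (1 / 2 + 1 / 2 * x) * padic_Gamma (1 - 1 / 2 * x) *
                padic_Gamma (1 / 2 + \<beta> - 1 / 2 * x) * padic_Gamma (\<beta> + 1 / 2 * x))" for x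
  have hyp: "trunc_hypergeo [\<alpha>, 1 - \<alpha>, \<beta>] [1, 2 * \<beta>] 1 (p - 1) = S \<alpha>"
    unfolding trunc_hypergeo_def S_def W_def p by (rule sum.cong) (simp_all add: pochhammer_fact[symmetric] mult_ac)
  have W: "W k \<in> padic_ints" if "k \<le> CARD('p) - 1" for k
  proof -
    have "\<not> CARD('p) dvd fact k"
      using that prime_dvd_fact_iff[OF prime_CARD_prime_card[where 'p = 'p], of k]
        CARD_prime_card_gt_1[where 'p = 'p] by simp
    then have "padic_unit (of_int (int (fact k)) :: 'p padic)"
      by (simp only: padic_unit_of_int_iff of_nat_dvd_iff not_False_eq_True)
    then have u: "padic_unit (fact k :: 'p padic)" by simp
    have ratio: "W k = pochhammer \<beta> k / pochhammer (2 * \<beta>) k / (fact k * fact k)"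
      by (simp add: W_def)
    show ?thesis
      unfolding ratio using u by (intro padic_ints_divide padic_unit_mult pochhammer_ratio_ints[OF odd b t nz that])
  qed
  \<comment> \<open>An exact equality, not only a congruence; \<open>n < p\<close> makes the
    truncation at \<open>p - 1\<close> harmless.\<close>
  have closed_form: "S (- of_nat n) = (if even n then G (- of_nat n) else 0)" if "n < CARD('p)" for n
  proof -
    have "S (- of_nat n) = (\<Sum>k\<le>CARD('p) - 1. pochhammer (- of_nat n) k * pochhammer (1 + of_nat n) k * pochhammer \<beta> k
        / (fact k * fact k * pochhammer (2 * \<beta>) k))"
      by (simp add: S_def W_def)
    also have "\<dots> = (if even n then pochhammer (1 / 2) (n div 2) * pochhammer (1 - \<beta>) (n div 2)
        / (fact (n div 2) * pochhammer (\<beta> + 1 / 2) (n div 2)) else 0)"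
      using that nz by (intro whipple_terminating) auto
    also have "\<dots> = (if even n then G (- of_nat n) else 0)"
    proof (cases "even n")
      case True
      then obtain m where n: "n = 2 * m" by blast
      show ?thesis
        using padic_Gamma_quotient_even[OF odd b t, of m] that by (simp add: n G_def)
    qed simp
    finally show ?thesis .
  qed
  have sym: "S (1 - x) = S x" "G (1 - x) = G x" for x
  proof -
    show "S (1 - x) = S x" by (simp add: S_def mult_ac)
    have "1 / 2 + 1 / 2 * (1 - x) = 1 - 1 / 2 * x" "1 - 1 / 2 * (1 - x) = 1 / 2 + 1 / 2 * x"
      "1 / 2 + \<beta> - 1 / 2 * (1 - x) = \<beta> + 1 / 2 * x" "\<beta> + 1 / 2 * (1 - x) = 1 / 2 + \<beta> - 1 / 2 * x"
      by (simp_all add: field_simps)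
    then show "G (1 - x) = G x"
      unfolding G_def by (simp only: mult_ac)
  qed
  \<comment> \<open>At \<open>s = 1\<close> the parameter itself is not a nonpositive integer; its
    reflection is, since \<open>a \<le> p - 1\<close>. The parity is kept because
    \<open>p - 1\<close> is even.\<close>
  have reflect: "1 - (- of_nat a + ?p * 1) = - of_nat (CARD('p) - 1 - a)"
    using a by (simp add: of_nat_diff)
  have parity: "even (CARD('p) - 1 - a) \<longleftrightarrow> even a"
    using a odd by auto
  have closed_form1: "S (- of_nat a + ?p * 1) = (if even a then G (- of_nat a + ?p * 1) else 0)"
  proof -
    have "CARD('p) - 1 - a < CARD('p)" using a by simp
    from closed_form[OF this] show ?thesis
      by (simp only: parity sym[of "- of_nat a + ?p * 1", unfolded reflect])
  qed
  have closed_form0: "S (- of_nat a + ?p * 0) = (if even a then G (- of_nat a + ?p * 0) else 0)"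
    using closed_form[OF a] by simp
  have lin: "affine_mod_sq (\<lambda>s. c + d * (- of_nat a + ?p * s))" if "c \<in> padic_ints" "d \<in> padic_ints" for c d
    using affine_mod_sq_affine[of "c - d * of_nat a" d] that by (simp add: algebra_simps)
  have affine_S: "affine_mod_sq (\<lambda>s. S (- of_nat a + ?p * s))"
    unfolding S_def pochhammer_prod
  proof (intro affine_mod_sq_sum affine_mod_sq_mult affine_mod_sq_prod affine_mod_sq_const)
    show "affine_mod_sq (\<lambda>s. - of_nat a + ?p * s + of_nat i)" for i
      using lin[of "of_nat i" 1] by (simp add: algebra_simps)
    show "affine_mod_sq (\<lambda>s. 1 - (- of_nat a + ?p * s) + of_nat i)" for i
      using lin[of "1 + of_nat i" "- 1"] by (simp add: algebra_simps)
  qed (use W in auto)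
  have affine_Gamma: "affine_mod_sq (\<lambda>s. padic_Gamma (c + d * (- of_nat a + ?p * s)))"
    if "c \<in> padic_ints" "d \<in> padic_ints" for c d
    using affine_mod_sq_Gamma[OF odd, of "c - d * of_nat a" d] that by (simp add: algebra_simps)
  have affine_G: "affine_mod_sq (\<lambda>s. G (- of_nat a + ?p * s))"
  proof -
    \<comment> \<open>The differences are written as \<open>c + d * x\<close> so that
      \<open>affine_Gamma\<close> applies to all four factors.\<close>
    define D where "D x = padic_Gamma (1 / 2 + 1 / 2 * x) * padic_Gamma (1 + - (1 / 2) * x) *
        padic_Gamma (1 / 2 + \<beta> + - (1 / 2) * x) * padic_Gamma (\<beta> + 1 / 2 * x)" for x
    have "G x = - (padic_Gamma (1 / 2) * padic_Gamma (1 / 2 + \<beta>) * padic_Gamma \<beta>) / D x" for x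
      by (simp add: G_def D_def)
    then have G: "G x = - (padic_Gamma (1 / 2) * padic_Gamma (1 / 2 + \<beta>) * padic_Gamma \<beta>) * inverse (D x)" for x
      by (simp only: divide_inverse[of _ "D x"])
    show ?thesis
      unfolding G
    proof (intro affine_mod_sq_mult affine_mod_sq_inverse affine_mod_sq_const)
      show "affine_mod_sq (\<lambda>s. D (- of_nat a + ?p * s))"
        unfolding D_def using half \<open>\<beta> \<in> padic_ints\<close>
        by (intro affine_mod_sq_mult affine_Gamma) auto
      show "padic_unit (D (- of_nat a + ?p * s))" if "s \<in> padic_ints" for s
        unfolding D_def using half \<open>\<beta> \<in> padic_ints\<close> that
        by (intro padic_unit_mult padic_unit_Gamma odd padic_ints_closed) auto
    qed (use half \<open>\<beta> \<in> padic_ints\<close> in \<open>auto intro!: padic_Gamma_ints odd padic_ints_closed\<close>)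
  qed
  have "padic_cong 2 (S \<alpha>) (G \<alpha>)" if "even a"
    using affine_mod_sq_determined[OF affine_S affine_G _ _ s(1)] closed_form0 closed_form1 that by (simp add: s(2))
  \<comment> \<open>Here the comparison function is the constant 0, since both terminating sums
    vanish.\<close>
  moreover have "padic_cong 2 (S \<alpha>) 0" if "odd a"
    using affine_mod_sq_determined[OF affine_S affine_mod_sq_const[of 0] _ _ s(1)] closed_form0 closed_form1 that by (simp add: s(2))
  ultimately show ?thesis
    unfolding hyp G_def a_def by blast
qed

end
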